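(* For every constant positive integer $k$, the $k$-EDSP problem can be solved in weighted DAGs in $O(mn^{k-1})$ time.
   Context: In the $k$-Edge Disjoint Shortest Paths problem ($k$-EDSP), the input is a graph $G$ with $n$ vertices, $m$ edges and positive edge weights, together with sources $s_1,\dots,s_k$ and targets $t_1,\dots,t_k$; the task is to decide whether there exist pairwise edge-disjoint paths $P_1,\dots,P_k$ with each $P_i$ a shortest $(s_i,t_i)$-path in $G$. *)

theory Defs
  imports Complex_Main "Graph_Theory.Graph_Theory"
begin

section \<open>Edge-disjoint shortest paths\<close>

definition weighted_dag :: "('a, 'b) pre_digraph \<Rightarrow> ('b \<Rightarrow> real) \<Rightarrow> bool" where
  "weighted_dag G w \<longleftrightarrow>
     digraph G \<and> (\<nexists>p. pre_digraph.cycle G p) \<and> (\<forall>e \<in> arcs G. 0 < w e)"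

definition shortest_path ::
    "('a, 'b) pre_digraph \<Rightarrow> ('b \<Rightarrow> real) \<Rightarrow> 'a \<Rightarrow> 'b list \<Rightarrow> 'a \<Rightarrow> bool" where
  "shortest_path G w u p v \<longleftrightarrow>
     pre_digraph.apath G u p v \<and>
     (\<forall>q. pre_digraph.apath G u q v \<longrightarrow> wf_digraph.awalk_cost w p \<le> wf_digraph.awalk_cost w q)"

definition edsp ::
    "nat \<Rightarrow> ('a, 'b) pre_digraph \<Rightarrow> ('b \<Rightarrow> real) \<Rightarrow> (nat \<Rightarrow> 'a) \<Rightarrow> (nat \<Rightarrow> 'a) \<Rightarrow> bool" where
  "edsp k G w s t \<longleftrightarrow>
     (\<exists>P. (\<forall>i<k. shortest_path G w (s i) (P i) (t i)) \<and>
          (\<forall>i<k. \<forall>j<k. i \<noteq> j \<longrightarrow> set (P i) \<inter> set (P j) = {}))"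


section \<open>Word RAM with real weights\<close>

text \<open>
  The machine model is a word RAM in the form of a structured imperative language. A state
  consists of word variables, word arrays and weight arrays; variables and arrays are named by
  natural numbers, and a program, being a finite text, mentions only finitely many of them.
  Words have \<open>b\<close> bits: word arithmetic is taken modulo \<open>2 ^ b\<close>, except that subtraction is
  truncated at 0, and array indices are words.

  Weights are arbitrary reals that live in memory cells of their own. They can only be copied,
  added and compared; the outcome of a comparison can be used in tests, but there is no
  conversion between weights and words.
\<close>

record state =
  var :: "nat \<Rightarrow> nat"
  arr :: "nat \<Rightarrow> nat \<Rightarrow> nat"
  wgt :: "nat \<Rightarrow> nat \<Rightarrow> real"

datatype wexp =
    Const nat
  | Var nat
  | Arr nat wexp
  | Add wexp wexp
  | Sub wexp wexp
  | Mul wexp wexp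
  | Div wexp wexp
  | Mod wexp wexp

datatype rexp =
    RZero
  | RArr nat wexp
  | RAdd rexp rexp

datatype bexp =
    Less wexp wexp
  | RLess rexp rexp
  | BNot bexp
  | BAnd bexp bexp

datatype com =
    Skip
  | Assign nat wexp
  | AssignArr nat wexp wexp
  | AssignWgt nat wexp rexp
  | Seq com com
  | Cond bexp com com
  | While bexp com

fun weval :: "nat \<Rightarrow> state \<Rightarrow> wexp \<Rightarrow> nat" where
  "weval b \<sigma> (Const c) = c mod 2 ^ b"
| "weval b \<sigma> (Var x) = var \<sigma> x"
| "weval b \<sigma> (Arr a e) = arr \<sigma> a (weval b \<sigma> e)"
| "weval b \<sigma> (Add e f) = (weval b \<sigma> e + weval b \<sigma> f) mod 2 ^ b"
| "weval b \<sigma> (Sub e f) = weval b \<sigma> e - weval b \<sigma> f"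
| "weval b \<sigma> (Mul e f) = (weval b \<sigma> e * weval b \<sigma> f) mod 2 ^ b"
| "weval b \<sigma> (Div e f) = weval b \<sigma> e div weval b \<sigma> f"
| "weval b \<sigma> (Mod e f) = weval b \<sigma> e mod weval b \<sigma> f"

fun reval :: "nat \<Rightarrow> state \<Rightarrow> rexp \<Rightarrow> real" where
  "reval b \<sigma> RZero = 0"
| "reval b \<sigma> (RArr a e) = wgt \<sigma> a (weval b \<sigma> e)"
| "reval b \<sigma> (RAdd x y) = reval b \<sigma> x + reval b \<sigma> y"

fun beval :: "nat \<Rightarrow> state \<Rightarrow> bexp \<Rightarrow> bool" where
  "beval b \<sigma> (Less e f) \<longleftrightarrow> weval b \<sigma> e < weval b \<sigma> f"
| "beval b \<sigma> (RLess x y) \<longleftrightarrow> reval b \<sigma> x < reval b \<sigma> y"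
| "beval b \<sigma> (BNot c) \<longleftrightarrow> \<not> beval b \<sigma> c"
| "beval b \<sigma> (BAnd c d) \<longleftrightarrow> beval b \<sigma> c \<and> beval b \<sigma> d"

text \<open>
  \<open>exec b c \<sigma> T \<tau>\<close>: on words of \<open>b\<close> bits, command \<open>c\<close> started in \<open>\<sigma>\<close> terminates in \<open>\<tau>\<close> after
  \<open>T\<close> steps. Every assignment and every evaluation of a test is charged one step; as the
  expressions are part of the program text, this agrees with counting individual operations
  up to a constant factor depending only on the program.
\<close>

inductive exec :: "nat \<Rightarrow> com \<Rightarrow> state \<Rightarrow> nat \<Rightarrow> state \<Rightarrow> bool" for b where
  Skip: "exec b Skip \<sigma> 1 \<sigma>"
| Assign: "exec b (Assign x e) \<sigma> 1 (\<sigma>\<lparr>var := (var \<sigma>)(x := weval b \<sigma> e)\<rparr>)"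
| AssignArr: "exec b (AssignArr a i e) \<sigma> 1
    (\<sigma>\<lparr>arr := (arr \<sigma>)(a := (arr \<sigma> a)(weval b \<sigma> i := weval b \<sigma> e))\<rparr>)"
| AssignWgt: "exec b (AssignWgt a i x) \<sigma> 1
    (\<sigma>\<lparr>wgt := (wgt \<sigma>)(a := (wgt \<sigma> a)(weval b \<sigma> i := reval b \<sigma> x))\<rparr>)"
| Seq: "exec b c \<sigma> T \<rho> \<Longrightarrow> exec b d \<rho> U \<tau> \<Longrightarrow> exec b (Seq c d) \<sigma> (T + U) \<tau>"
| CondTrue: "beval b \<sigma> g \<Longrightarrow> exec b c \<sigma> T \<tau> \<Longrightarrow> exec b (Cond g c d) \<sigma> (1 + T) \<tau>"
| CondFalse: "\<not> beval b \<sigma> g \<Longrightarrow> exec b d \<sigma> T \<tau> \<Longrightarrow> exec b (Cond g c d) \<sigma> (1 + T) \<tau>"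
| WhileFalse: "\<not> beval b \<sigma> g \<Longrightarrow> exec b (While g c) \<sigma> 1 \<sigma>"
| WhileTrue: "beval b \<sigma> g \<Longrightarrow> exec b c \<sigma> T \<rho> \<Longrightarrow> exec b (While g c) \<rho> U \<tau> \<Longrightarrow>
    exec b (While g c) \<sigma> (1 + T + U) \<tau>"

inductive_cases exec_SkipE: "exec b Skip \<sigma> T \<tau>"
inductive_cases exec_AssignE: "exec b (Assign x e) \<sigma> T \<tau>"
inductive_cases exec_AssignArrE: "exec b (AssignArr a i e) \<sigma> T \<tau>"
inductive_cases exec_AssignWgtE: "exec b (AssignWgt a i r) \<sigma> T \<tau>"
inductive_cases exec_SeqE: "exec b (Seq c d) \<sigma> T \<tau>"
inductive_cases exec_CondE: "exec b (Cond g c d) \<sigma> T \<tau>"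
inductive_cases exec_WhileE: "exec b (While g c) \<sigma> T \<tau>"

lemma exec_deterministic:
  assumes "exec b c \<sigma> T \<tau>" and "exec b c \<sigma> T' \<tau>'"
  shows "T' = T \<and> \<tau>' = \<tau>"
  using assms
proof (induction arbitrary: T' \<tau>' rule: exec.induct)
  case (Skip \<sigma>)
  then show ?case by (auto elim: exec_SkipE)
next
  case (Assign x e \<sigma>)
  then show ?case by (auto elim: exec_AssignE)
next
  case (AssignArr a i e \<sigma>)
  then show ?case by (auto elim: exec_AssignArrE)
next
  case (AssignWgt a i x \<sigma>)
  then show ?case by (auto elim: exec_AssignWgtE)
next
  case (Seq c \<sigma> T \<rho> d U \<tau>)
  from Seq.prems show ?case
    by (rule exec_SeqE) (metis Seq.IH)
next
  case (CondTrue \<sigma> g c T \<tau> d)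
  from CondTrue.prems show ?case
    by (rule exec_CondE) (auto simp: CondTrue.hyps(1) dest: CondTrue.IH)
next
  case (CondFalse \<sigma> g d T \<tau> c)
  from CondFalse.prems show ?case
    by (rule exec_CondE) (auto simp: CondFalse.hyps(1) dest: CondFalse.IH)
next
  case (WhileFalse \<sigma> g c)
  from WhileFalse.prems show ?case
    by (rule exec_WhileE) (simp_all add: WhileFalse.hyps)
next
  case (WhileTrue \<sigma> g c T \<rho> U \<tau>)
  from WhileTrue.prems show ?case
    by (rule exec_WhileE) (auto simp: WhileTrue.hyps(1) dest: WhileTrue.IH)
qed


section \<open>Inputs\<close>

text \<open>
  A graph on the vertices \<open>0, \<dots>, n - 1\<close> with arcs \<open>0, \<dots>, m - 1\<close> is given as an unsorted arc
  list. All memory cells that do not hold part of the input are initially 0.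
\<close>

definition edsp_input ::
    "nat \<Rightarrow> (nat, nat) pre_digraph \<Rightarrow> (nat \<Rightarrow> real) \<Rightarrow> (nat \<Rightarrow> nat) \<Rightarrow> (nat \<Rightarrow> nat) \<Rightarrow> state" where
  "edsp_input k G w s t =
     \<lparr>var = (\<lambda>_. 0)(0 := card (verts G), 1 := card (arcs G)),
      arr = (\<lambda>_ _. 0)
        (0 := (\<lambda>e. if e \<in> arcs G then tail G e else 0),
         1 := (\<lambda>e. if e \<in> arcs G then head G e else 0),
         2 := (\<lambda>i. if i < k then s i else 0),
         3 := (\<lambda>i. if i < k then t i else 0)),
      wgt = (\<lambda>_ _. 0)(0 := (\<lambda>e. if e \<in> arcs G then w e else 0))\<rparr>"

text \<open>
  The program \<open>c\<close> decides \<open>k\<close>-EDSP on weighted DAGs, leaving the answer in variable 0, within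
  \<open>f n m\<close> steps on words of \<open>O(log n)\<close> bits: any word length \<open>b\<close> with \<open>2 ^ b \<ge> (n + 2) ^ d\<close>
  suffices, where \<open>d\<close> is a constant.
\<close>

definition solves_edsp_dag :: "nat \<Rightarrow> com \<Rightarrow> nat \<Rightarrow> (nat \<Rightarrow> nat \<Rightarrow> nat) \<Rightarrow> bool" where
  "solves_edsp_dag k c d f \<longleftrightarrow>
     (\<forall>n m b G w s t.
        verts G = {..<n} \<longrightarrow> arcs G = {..<m} \<longrightarrow> weighted_dag G w \<longrightarrow>
        (\<forall>i<k. s i \<in> verts G \<and> t i \<in> verts G) \<longrightarrow> (n + 2) ^ d \<le> 2 ^ b \<longrightarrow>
        (\<exists>T \<tau>. exec b c (edsp_input k G w s t) T \<tau> \<and> T \<le> f n m \<and>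
               var \<tau> 0 = (if edsp k G w s t then 1 else 0)))"

end

theory Submission
  imports Defs
begin

text \<open>
  The arcs are sorted so that every arc comes after all arcs entering its tail. A walk that uses only
  the first \<open>i + 1\<close> arcs of this order can use the last of them only as its final arc. Hence
  single-source distances arise from relaxing every arc once in this order, and a walk from \<open>s\<^sub>j\<close>
  is shortest if and only if all its arcs are tight for the distances from \<open>s\<^sub>j\<close>.

  The tuples of end points of edge-disjoint tight walks from \<open>s\<^sub>1, \<dots>, s\<^sub>k\<close> inside the first
  \<open>i\<close> arcs are computed by going through the same order: the arc \<open>e\<close> at position \<open>i\<close> adds to
  them the tuples that arise by moving a single coordinate from the tail of \<open>e\<close> to its head.
  Edge-disjointness is automatic, as every arc is considered once and serves one coordinate only.
  For each arc and coordinate there are \<open>n ^ (k - 1)\<close> tuples to be examined.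

  For \<open>k = 1\<close> there is no time to visit all vertices, so sorting must take time \<open>O(m)\<close>: Kahn's
  algorithm is run with the sorted arc list itself as its queue.
\<close>

section \<open>Walks along a topological order of the arcs\<close>

text \<open>A repeated vertex cuts out a nonempty closed subwalk. In an acyclic graph every walk is
  therefore a path, so minimality among paths can be tested among walks.\<close>

lemma (in wf_digraph) not_distinct_imp_cycle:
  assumes "awalk u p v" "\<not> distinct (awalk_verts u p)"
  shows "\<exists>c. cycle c"
proof -
  obtain q r s where "\<exists>w. awalk u q w \<and> awalk w r w \<and> awalk w s v" "r \<noteq> []"
    using awalk_not_distinct_decomp[OF assms] by auto
  then have "closed_w r" by (auto simp: closed_w_def)
  then show ?thesis by (rule closed_w_imp_cycle)
qed

locale arc_order = wf_digraph +
  fixes m :: nat and ord :: "nat \<Rightarrow> 'b"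
  assumes bij_ord: "bij_betw ord {..<m} (arcs G)"
    and ord_mono: "\<And>x y. x < m \<Longrightarrow> y < m \<Longrightarrow> head G (ord x) = tail G (ord y) \<Longrightarrow> x < y"
begin

section \<open>Walks inside a prefix of the arc order\<close>

definition walk_upto :: "nat \<Rightarrow> 'a \<Rightarrow> 'b list \<Rightarrow> 'a \<Rightarrow> bool" where
  "walk_upto i u p v \<longleftrightarrow> awalk u p v \<and> set p \<subseteq> ord ` {..<i}"

lemma ord_in_arcs: "i < m \<Longrightarrow> ord i \<in> arcs G"
  using bij_ord by (auto simp: bij_betw_def)

lemma ord_notin_image: "i < m \<Longrightarrow> ord i \<notin> ord ` {..<i}"
  using bij_ord by (fastforce simp: bij_betw_def inj_on_def)

lemma walk_upto_0: "walk_upto 0 u p v \<longleftrightarrow> p = [] \<and> u = v \<and> u \<in> verts G"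
  by (auto simp: walk_upto_def awalk_Nil_iff)

lemma walk_upto_all: "walk_upto m u p v \<longleftrightarrow> awalk u p v"
  using bij_ord by (auto simp: walk_upto_def bij_betw_def)

lemma arc_after_ord_later:
  assumes "i < m" "awalk u (p @ ord i # f # q) v"
  shows "f \<notin> ord ` {..i}"
proof
  assume "f \<in> ord ` {..i}"
  then obtain x where x: "x \<le> i" "f = ord x" by auto
  from assms(2) have "head G (ord i) = tail G f"
    by (auto simp: awalk_Cons_iff)
  with x assms(1) have "i < x" using ord_mono[of i x] by simp
  with x show False by simp
qed

text \<open>An arc following \<open>ord i\<close> in the walk would have to stand after position
  \<open>i\<close> in the order, so nothing can follow it.\<close>

lemma walk_upto_split:
  assumes "i < m" "walk_upto (Suc i) u p v" "ord i \<in> set p"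
  obtains p' where "p = p' @ [ord i]" "walk_upto i u p' (tail G (ord i))" "v = head G (ord i)"
proof -
  from assms(2) have w: "awalk u p v" and s: "set p \<subseteq> ord ` {..i}"
    by (auto simp: walk_upto_def lessThan_Suc_atMost)
  from assms(3) obtain xs ys where p: "p = xs @ ord i # ys" "ord i \<notin> set xs"
    by (meson split_list_first)
  have "ys = []"
  proof (cases ys)
    case (Cons f q)
    with arc_after_ord_later[OF assms(1), of u xs f q v] w p s show ?thesis by auto
  qed simp
  moreover have "set xs \<subseteq> ord ` {..<i}"
    using s p by (auto simp: lessThan_Suc_atMost[symmetric] lessThan_Suc)
  ultimately show ?thesis
    using p w by (intro that[of xs]) (auto simp: walk_upto_def awalk_Cons_iff awalk_Nil_iff)
qed

lemma walk_upto_snoc: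
  assumes "i < m" "walk_upto i u p (tail G (ord i))"
  shows "walk_upto (Suc i) u (p @ [ord i]) (head G (ord i))"
  using assms ord_in_arcs[of i]
  by (auto simp: walk_upto_def awalk_simps)

lemma walk_upto_SucI: "walk_upto i u p v \<Longrightarrow> walk_upto (Suc i) u p v"
  by (force simp: walk_upto_def)

lemma walk_upto_SucD: "walk_upto (Suc i) u p v \<Longrightarrow> ord i \<notin> set p \<Longrightarrow> walk_upto i u p v"
  by (auto simp: walk_upto_def lessThan_Suc)

section \<open>Distances by relaxation along the order\<close>

text \<open>\<open>R\<close> marks the finite distances: there is no infinite real, so
  \<open>d\<close> is left arbitrary where \<open>R\<close> fails.\<close>

definition dist_upto ::
    "('b \<Rightarrow> real) \<Rightarrow> 'a \<Rightarrow> nat \<Rightarrow> ('a \<Rightarrow> bool) \<Rightarrow> ('a \<Rightarrow> real) \<Rightarrow> bool" where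
  "dist_upto w s i R d \<longleftrightarrow>
     (\<forall>v p. walk_upto i s p v \<longrightarrow> R v \<and> d v \<le> awalk_cost w p) \<and>
     (\<forall>v. R v \<longrightarrow> (\<exists>p. walk_upto i s p v \<and> awalk_cost w p = d v))"

lemma dist_upto_0:
  "s \<in> verts G \<Longrightarrow> d s = 0 \<Longrightarrow> dist_upto w s 0 (\<lambda>v. v = s) d"
  by (auto simp: dist_upto_def walk_upto_0)

text \<open>The only new walks end with \<open>ord i\<close> and extend an old walk to its tail.
  \<open>better\<close> has the shape of the test in \<open>relax_arcs\<close>, which the step
  thereby mirrors.\<close>

lemma dist_upto_Suc:
  fixes w s R d i
  defines "a \<equiv> tail G (ord i)" and "b \<equiv> head G (ord i)"
  defines "better \<equiv> R a \<and> \<not> (R b \<and> \<not> d a + w (ord i) < d b)"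
  assumes i: "i < m" and D: "dist_upto w s i R d"
  shows "dist_upto w s (Suc i) (if better then R(b := True) else R)
           (if better then d(b := d a + w (ord i)) else d)"
    (is "dist_upto w s (Suc i) ?R ?d")
proof -
  have le: "R v \<and> d v \<le> awalk_cost w p" if "walk_upto i s p v" for v p
    using D that by (auto simp: dist_upto_def)
  have wit: "\<exists>p. walk_upto i s p v \<and> awalk_cost w p = d v" if "R v" for v
    using D that by (auto simp: dist_upto_def)
  show ?thesis
    unfolding dist_upto_def
  proof (intro conjI allI impI)
    fix v p assume p: "walk_upto (Suc i) s p v"
    have "?R v \<and> ?d v \<le> awalk_cost w p"
    proof (cases "ord i \<in> set p")
      case True
      then obtain p' where "p = p' @ [ord i]" "walk_upto i s p' a" "v = b"
        using walk_upto_split[OF i p] unfolding a_def b_def by blast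
      with le[of p' a] show ?thesis by (auto simp: better_def)
    next
      case False
      with le[OF walk_upto_SucD[OF p]] show ?thesis by (auto simp: better_def)
    qed
    then show "?R v" and "?d v \<le> awalk_cost w p" by auto
  next
    fix v assume v: "?R v"
    show "\<exists>p. walk_upto (Suc i) s p v \<and> awalk_cost w p = ?d v"
    proof (cases "better \<and> v = b")
      case True
      then have "R a" by (simp add: better_def)
      then obtain p where "walk_upto i s p a" "awalk_cost w p = d a" using wit by blast
      then show ?thesis
        using True walk_upto_snoc[OF i, of s p] unfolding a_def b_def
        by (intro exI[of _ "p @ [ord i]"]) auto
    next
      case False
      with v have "R v" by (auto split: if_splits)
      with False wit show ?thesis by (auto split: if_splits dest: walk_upto_SucI)
    qed
  qed
qed

text \<open>Final distances satisfy the triangle inequality, so the negated comparison amounts to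
  equality; it is the form that a machine restricted to \<open><\<close> can test.\<close>

definition tight :: "('b \<Rightarrow> real) \<Rightarrow> ('a \<Rightarrow> bool) \<Rightarrow> ('a \<Rightarrow> real) \<Rightarrow> 'b \<Rightarrow> bool" where
  "tight w R d e \<longleftrightarrow> R (tail G e) \<and> \<not> d (head G e) < d (tail G e) + w e"

text \<open>The least cost of a walk to \<open>v\<close> is \<open>d v\<close>. By induction from
  the last arc, a walk attains it exactly if no arc loses anything against the distances.\<close>

lemma minimal_walk_iff_tight:
  assumes acyclic: "\<nexists>c. cycle c"
    and D: "dist_upto w s m R d" and s: "s \<in> verts G" and p: "awalk s p v"
  shows "(\<forall>q. awalk s q v \<longrightarrow> awalk_cost w p \<le> awalk_cost w q) \<longleftrightarrow> (\<forall>e \<in> set p. tight w R d e)"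
proof -
  have le: "R v \<and> d v \<le> awalk_cost w p" if "awalk s p v" for v p
    using D that by (auto simp: dist_upto_def walk_upto_all)
  have wit: "\<exists>p. awalk s p v \<and> awalk_cost w p = d v" if "R v" for v
    using D that by (auto simp: dist_upto_def walk_upto_all)
  have cost_iff: "awalk_cost w p = d v \<longleftrightarrow> (\<forall>e \<in> set p. tight w R d e)" if "awalk s p v" for p v
    using that
  proof (induction p arbitrary: v rule: rev_induct)
    case Nil
    then have "v = s" by (simp add: awalk_Nil_iff)
    have "R s" using le[OF Nil] \<open>v = s\<close> by simp
    from wit[OF this] obtain q where q: "awalk s q s" "awalk_cost w q = d s" by blast
    \<comment> \<open>An optimal walk from \<open>s\<close> to itself is closed, hence empty by
      acyclicity; this gives \<open>d s = 0\<close>.\<close>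
    then have "q = []" using acyclic closed_w_imp_cycle by (auto simp: closed_w_def)
    with q \<open>v = s\<close> show ?case by simp
  next
    case (snoc e p)
    then have p: "awalk s p (tail G e)" and v: "v = head G e" and e: "e \<in> arcs G"
      by (auto simp: awalk_simps)
    from le[OF p] have "R (tail G e)" and 1: "d (tail G e) \<le> awalk_cost w p" by auto
    then obtain q where q: "awalk s q (tail G e)" "awalk_cost w q = d (tail G e)"
      using wit by blast
    \<comment> \<open>Extending an optimal walk to the tail of \<open>e\<close> gives the triangle
      inequality. In \<open>d v \<le> d (tail G e) + w e \<le> awalk_cost w p + w e\<close> the
      outer terms agree iff both inequalities are equalities.\<close>
    from q e have "awalk s (q @ [e]) v" by (auto simp: awalk_simps v)
    from le[OF this] have "d v \<le> d (tail G e) + w e" by (simp add: q)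
    with snoc.IH[OF p] 1 \<open>R (tail G e)\<close> show ?case by (auto simp: tight_def v)
  qed
  have "(\<forall>q. awalk s q v \<longrightarrow> awalk_cost w p \<le> awalk_cost w q) \<longleftrightarrow> awalk_cost w p = d v"
    using le wit p by (metis order_antisym order_refl)
  with cost_iff[OF p] show ?thesis by simp
qed

section \<open>Tuples of end points of edge-disjoint walks\<close>

definition routable :: "nat \<Rightarrow> (nat \<Rightarrow> 'b \<Rightarrow> bool) \<Rightarrow> (nat \<Rightarrow> 'a) \<Rightarrow> nat \<Rightarrow> (nat \<Rightarrow> 'a) \<Rightarrow> bool" where
  "routable k T s i u \<longleftrightarrow> (\<exists>P.
     (\<forall>j<k. walk_upto i (s j) (P j) (u j) \<and> (\<forall>e \<in> set (P j). T j e)) \<and>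
     (\<forall>i<k. \<forall>j<k. i \<noteq> j \<longrightarrow> set (P i) \<inter> set (P j) = {}))"

lemma routable_0:
  "(\<And>j. j < k \<Longrightarrow> s j \<in> verts G) \<Longrightarrow> routable k T s 0 u \<longleftrightarrow> (\<forall>j<k. u j = s j)"
  by (auto simp: routable_def walk_upto_0 intro!: exI[of _ "\<lambda>_. []"])

text \<open>By disjointness at most one walk uses \<open>ord i\<close>, necessarily as its last arc,
  and cutting it off moves one end point back. Conversely no walk inside the first \<open>i\<close>
  arcs contains \<open>ord i\<close>, so appending it to one of them keeps the walks
  disjoint.\<close>

lemma routable_Suc:
  assumes i: "i < m"
  shows "routable k T s (Suc i) u \<longleftrightarrow> routable k T s i u \<or>
    (\<exists>j<k. T j (ord i) \<and> u j = head G (ord i) \<and> routable k T s i (u(j := tail G (ord i))))"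
    (is "_ \<longleftrightarrow> _ \<or> ?step")
proof
  assume "routable k T s (Suc i) u"
  then obtain P where P: "\<And>j. j < k \<Longrightarrow> walk_upto (Suc i) (s j) (P j) (u j)"
    "\<And>j e. j < k \<Longrightarrow> e \<in> set (P j) \<Longrightarrow> T j e"
    and disj: "\<And>i j. i < k \<Longrightarrow> j < k \<Longrightarrow> i \<noteq> j \<Longrightarrow> set (P i) \<inter> set (P j) = {}"
    unfolding routable_def by blast
  show "routable k T s i u \<or> ?step"
  proof (cases "\<exists>j<k. ord i \<in> set (P j)")
    case False
    then have "\<And>j. j < k \<Longrightarrow> walk_upto i (s j) (P j) (u j)"
      using P(1) walk_upto_SucD by blast
    then have "routable k T s i u"
      using P(2) disj unfolding routable_def by blast
    then show ?thesis ..
  next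
    case True
    then obtain j where j: "j < k" "ord i \<in> set (P j)" by blast
    from walk_upto_split[OF i P(1)[OF j(1)] j(2)] obtain p' where
      p': "P j = p' @ [ord i]" "walk_upto i (s j) p' (tail G (ord i))" "u j = head G (ord i)"
      by blast
    have "ord i \<notin> set (P l)" if "l < k" "l \<noteq> j" for l
      using disj[OF that(1) j(1) that(2)] j(2) by auto
    moreover have "set p' \<inter> set (P l) = {}" if "l < k" "l \<noteq> j" for l
      using disj[OF that(1) j(1) that(2)] p'(1) by auto
    moreover have "walk_upto i (s l) ((P(j := p')) l) ((u(j := tail G (ord i))) l)"
      if "l < k" for l
      using that P(1)[OF that] calculation(1)[OF that] p'(2) walk_upto_SucD by simp
    ultimately have "routable k T s i (u(j := tail G (ord i)))"
      using P(2) disj p'(1) j unfolding routable_def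
      by (intro exI[of _ "P(j := p')"]) auto
    with j p' P(2)[of j "ord i"] show ?thesis by auto
  qed
next
  assume "routable k T s i u \<or> ?step"
  then show "routable k T s (Suc i) u"
  proof
    assume "routable k T s i u"
    then obtain P where "\<forall>j<k. walk_upto i (s j) (P j) (u j) \<and> (\<forall>e \<in> set (P j). T j e)"
      "\<forall>i<k. \<forall>j<k. i \<noteq> j \<longrightarrow> set (P i) \<inter> set (P j) = {}"
      unfolding routable_def by blast
    then show ?thesis
      unfolding routable_def by (intro exI[of _ P]) (simp add: walk_upto_SucI)
  next
    assume ?step
    then obtain j where j: "j < k" "T j (ord i)" "u j = head G (ord i)"
      and r: "routable k T s i (u(j := tail G (ord i)))" by blast
    from r obtain P where P: "\<And>l. l < k \<Longrightarrow> walk_upto i (s l) (P l) ((u(j := tail G (ord i))) l)"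
        "\<And>l e. l < k \<Longrightarrow> e \<in> set (P l) \<Longrightarrow> T l e"
      and disj: "\<And>i j. i < k \<Longrightarrow> j < k \<Longrightarrow> i \<noteq> j \<Longrightarrow> set (P i) \<inter> set (P j) = {}"
      unfolding routable_def by blast
    have fresh: "ord i \<notin> set (P l)" if "l < k" for l
      using P(1)[OF that] ord_notin_image[OF i] by (auto simp: walk_upto_def)
    have "walk_upto (Suc i) (s l) ((P(j := P j @ [ord i])) l) (u l)" if "l < k" for l
      using P(1)[OF that] j walk_upto_snoc[OF i, of "s l" "P l"]
      by (auto simp: walk_upto_SucI split: if_splits)
    then show ?thesis
      unfolding routable_def using j P(2) disj fresh
      by (intro exI[of _ "P(j := P j @ [ord i])"]) auto
  qed
qed

lemma edsp_iff_routable: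
  assumes acyclic: "\<nexists>c. cycle c"
    and s: "\<And>j. j < k \<Longrightarrow> s j \<in> verts G"
    and D: "\<And>j. j < k \<Longrightarrow> dist_upto w (s j) m (R j) (d j)"
  shows "edsp k G w s t \<longleftrightarrow> routable k (\<lambda>j. tight w (R j) (d j)) s m t"
proof -
  have apath: "apath u p v \<longleftrightarrow> awalk u p v" for u p v
    using acyclic not_distinct_imp_cycle by (auto simp: apath_def)
  have "shortest_path G w (s j) p (t j) \<longleftrightarrow>
      walk_upto m (s j) p (t j) \<and> (\<forall>e \<in> set p. tight w (R j) (d j) e)" if "j < k" for j p
    unfolding shortest_path_def apath walk_upto_all
    using minimal_walk_iff_tight[OF acyclic D[OF that] s[OF that]] by blast
  then show ?thesis
    unfolding edsp_def routable_def by (intro ex_cong1) auto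
qed

end


section \<open>Weakest preconditions with running time\<close>

definition wp :: "nat \<Rightarrow> com \<Rightarrow> (nat \<Rightarrow> state \<Rightarrow> bool) \<Rightarrow> state \<Rightarrow> bool" where
  "wp b c Q \<sigma> \<longleftrightarrow> (\<exists>T \<tau>. exec b c \<sigma> T \<tau> \<and> Q T \<tau>)"

lemma wp_conseq: "wp b c Q \<sigma> \<Longrightarrow> (\<And>T \<tau>. Q T \<tau> \<Longrightarrow> Q' T \<tau>) \<Longrightarrow> wp b c Q' \<sigma>"
  unfolding wp_def by blast

text \<open>Determinism makes one known run decide \<open>wp\<close>, which turns the rules below
  into equivalences fit for rewriting.\<close>

lemma wp_exec: "exec b c \<sigma> T \<tau> \<Longrightarrow> wp b c Q \<sigma> \<longleftrightarrow> Q T \<tau>"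
  unfolding wp_def using exec_deterministic by blast

lemma wp_Skip [simp]: "wp b Skip Q \<sigma> \<longleftrightarrow> Q 1 \<sigma>"
  by (rule wp_exec[OF exec.Skip])

lemma wp_Assign [simp]:
  "wp b (Assign x e) Q \<sigma> \<longleftrightarrow> Q 1 (\<sigma>\<lparr>var := (var \<sigma>)(x := weval b \<sigma> e)\<rparr>)"
  by (rule wp_exec[OF exec.Assign])

lemma wp_AssignArr [simp]:
  "wp b (AssignArr a i e) Q \<sigma> \<longleftrightarrow>
     Q 1 (\<sigma>\<lparr>arr := (arr \<sigma>)(a := (arr \<sigma> a)(weval b \<sigma> i := weval b \<sigma> e))\<rparr>)"
  by (rule wp_exec[OF exec.AssignArr])

lemma wp_AssignWgt [simp]:
  "wp b (AssignWgt a i x) Q \<sigma> \<longleftrightarrow>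
     Q 1 (\<sigma>\<lparr>wgt := (wgt \<sigma>)(a := (wgt \<sigma> a)(weval b \<sigma> i := reval b \<sigma> x))\<rparr>)"
  by (rule wp_exec[OF exec.AssignWgt])

lemma wp_Seq [simp]:
  "wp b (Seq c d) Q \<sigma> \<longleftrightarrow> wp b c (\<lambda>T. wp b d (\<lambda>U. Q (T + U))) \<sigma>"
  unfolding wp_def by (blast elim: exec_SeqE intro: exec.Seq)

lemma exec_Cond_iff:
  "exec b (Cond g c d) \<sigma> T \<tau> \<longleftrightarrow>
     (\<exists>U. T = 1 + U \<and> (if beval b \<sigma> g then exec b c \<sigma> U \<tau> else exec b d \<sigma> U \<tau>))"
  using exec.CondTrue[of b \<sigma> g c _ \<tau> d] exec.CondFalse[of b \<sigma> g d _ \<tau> c]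
  by (auto elim!: exec_CondE)

lemma wp_Cond [simp]:
  "wp b (Cond g c d) Q \<sigma> \<longleftrightarrow>
     (if beval b \<sigma> g then wp b c (\<lambda>T. Q (1 + T)) \<sigma> else wp b d (\<lambda>T. Q (1 + T)) \<sigma>)"
  unfolding wp_def exec_Cond_iff by auto

text \<open>The potential \<open>\<mu>\<close> pays for the iterations, which need not have a common cost bound.\<close>

lemma wp_While:
  assumes "I \<sigma>"
    and step: "\<And>\<rho>. I \<rho> \<Longrightarrow> beval b \<rho> g \<Longrightarrow> wp b c (\<lambda>T \<rho>'. I \<rho>' \<and> 1 + T + \<mu> \<rho>' \<le> \<mu> \<rho>) \<rho>"
    and exit: "\<And>T \<tau>. I \<tau> \<Longrightarrow> \<not> beval b \<tau> g \<Longrightarrow> T + \<mu> \<tau> \<le> Suc (\<mu> \<sigma>) \<Longrightarrow> Q T \<tau>"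
  shows "wp b (While g c) Q \<sigma>"
proof -
  \<comment> \<open>The extra \<open>Suc\<close> pays for the failing test. Every round lowers
    \<open>\<mu>\<close>, being charged at least for its own test, so induction on the potential
    also yields termination.\<close>
  have "\<exists>T \<tau>. exec b (While g c) \<rho> T \<tau> \<and> I \<tau> \<and> \<not> beval b \<tau> g \<and> T + \<mu> \<tau> \<le> Suc (\<mu> \<rho>)" if "I \<rho>" for \<rho>
    using that
  proof (induction "\<mu> \<rho>" arbitrary: \<rho> rule: less_induct)
    case less
    show ?case
    proof (cases "beval b \<rho> g")
      case True
      from step[OF less.prems True] obtain T \<rho>' where
        "exec b c \<rho> T \<rho>'" "I \<rho>'" "1 + T + \<mu> \<rho>' \<le> \<mu> \<rho>"
        unfolding wp_def by blast
      moreover from less.hyps[of \<rho>'] this obtain U \<tau> where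
        "exec b (While g c) \<rho>' U \<tau>" "I \<tau>" "\<not> beval b \<tau> g" "U + \<mu> \<tau> \<le> Suc (\<mu> \<rho>')"
        by auto
      ultimately show ?thesis
        using exec.WhileTrue[OF True] by (intro exI[of _ "1 + T + U"] exI[of _ \<tau>]) simp
    next
      case False
      with less.prems show ?thesis by (auto intro!: exI[of _ 1] exI[of _ \<rho>] exec.WhileFalse)
    qed
  qed
  from this[OF assms(1)] exit show ?thesis unfolding wp_def by blast
qed

definition For :: "nat \<Rightarrow> wexp \<Rightarrow> com \<Rightarrow> com" where
  "For x e c = Seq (Assign x (Const 0))
     (While (Less (Var x) e) (Seq c (Assign x (Add (Var x) (Const 1)))))"

text \<open>A round costs the body, one test and one increment, hence \<open>t + 2\<close>; the
  leading 2 is the initialisation and the failing test. \<open>N < 2 ^ b\<close> keeps the counter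
  from wrapping around.\<close>

lemma wp_For:
  assumes N: "N < 2 ^ b"
    and init: "J 0 (\<sigma>\<lparr>var := (var \<sigma>)(x := 0)\<rparr>)"
    and bound: "\<And>i \<rho>. J i \<rho> \<Longrightarrow> weval b \<rho> e = N"
    and body: "\<And>i \<rho>. i < N \<Longrightarrow> var \<rho> x = i \<Longrightarrow> J i \<rho> \<Longrightarrow>
      wp b c (\<lambda>T \<tau>. T \<le> t \<and> var \<tau> x = i \<and> J (Suc i) (\<tau>\<lparr>var := (var \<tau>)(x := Suc i)\<rparr>)) \<rho>"
    and exit: "\<And>T \<tau>. J N \<tau> \<Longrightarrow> var \<tau> x = N \<Longrightarrow> T \<le> 2 + N * (t + 2) \<Longrightarrow> Q T \<tau>"
  shows "wp b (For x e c) Q \<sigma>"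
proof -
  define \<sigma>' where "\<sigma>' = \<sigma>\<lparr>var := (var \<sigma>)(x := 0)\<rparr>"
  have "wp b (While (Less (Var x) e) (Seq c (Assign x (Add (Var x) (Const 1))))) (\<lambda>T. Q (1 + T)) \<sigma>'"
  proof (rule wp_While[where I = "\<lambda>\<rho>. var \<rho> x \<le> N \<and> J (var \<rho> x) \<rho>"
        and \<mu> = "\<lambda>\<rho>. (N - var \<rho> x) * (t + 2)"])
    show "var \<sigma>' x \<le> N \<and> J (var \<sigma>' x) \<sigma>'" using init by (simp add: \<sigma>'_def)
  next
    fix \<rho> assume I: "var \<rho> x \<le> N \<and> J (var \<rho> x) \<rho>" and g: "beval b \<rho> (Less (Var x) e)"
    define i where "i = var \<rho> x"
    have i: "i < N" "J i \<rho>" using I g bound[of i \<rho>] by (auto simp: i_def)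
    \<comment> \<open>The constant 1 is itself reduced modulo \<open>2 ^ b\<close>, so the increment
      is right only for \<open>0 < b\<close>.\<close>
    then have "Suc i < 2 ^ b" "0 < b" using N by (linarith, cases b) auto
    then have mod: "(i + 1 mod 2 ^ b) mod 2 ^ b = Suc i" by simp
    have "N - i = Suc (N - Suc i)" using i by simp
    then show "wp b (Seq c (Assign x (Add (Var x) (Const 1))))
       (\<lambda>T \<rho>'. (var \<rho>' x \<le> N \<and> J (var \<rho>' x) \<rho>') \<and> 1 + T + (N - var \<rho>' x) * (t + 2)
          \<le> (N - var \<rho> x) * (t + 2)) \<rho>"
      unfolding wp_Seq wp_Assign
      using i mod by (intro wp_conseq[OF body[OF i(1) i_def[symmetric] i(2)]]) (auto simp: i_def)
  next
    fix T \<tau> assume "var \<tau> x \<le> N \<and> J (var \<tau> x) \<tau>" "\<not> beval b \<tau> (Less (Var x) e)"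
      "T + (N - var \<tau> x) * (t + 2) \<le> Suc ((N - var \<sigma>' x) * (t + 2))"
    moreover from this bound[of "var \<tau> x" \<tau>] have "var \<tau> x = N" by auto
    ultimately show "Q (1 + T) \<tau>" by (intro exit) (auto simp: \<sigma>'_def)
  qed
  then show ?thesis by (simp add: For_def \<sigma>'_def)
qed


section \<open>Tuples as numbers in base \<open>n\<close>\<close>

definition digit :: "nat \<Rightarrow> nat \<Rightarrow> nat \<Rightarrow> nat" where
  "digit n j c = c div n ^ j mod n"

text \<open>The upper part of \<open>r\<close> is shifted up by one place and \<open>a\<close> fills
  the gap, so \<open>r\<close> codes the other \<open>k - 1\<close> coordinates. The sum is arranged
  as \<open>tuple_code\<close> computes it.\<close>

definition insert_digit :: "nat \<Rightarrow> nat \<Rightarrow> nat \<Rightarrow> nat \<Rightarrow> nat" where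
  "insert_digit n j a r = r div n ^ j * (n ^ j * n) + r mod n ^ j + a * n ^ j"

lemma mult_add_less: "x < y \<Longrightarrow> a < n \<Longrightarrow> x * n + a < y * n" for a n x y :: nat
  using mult_le_mono1[of "Suc x" y n] by simp

lemma insert_digit_eq:
  "insert_digit n j a r = (r div n ^ j * n + a) * n ^ j + r mod n ^ j"
  by (simp add: insert_digit_def algebra_simps)

lemma digit_insert_digit_same: "a < n \<Longrightarrow> digit n j (insert_digit n j a r) = a"
  by (simp add: digit_def insert_digit_eq)

text \<open>Below position \<open>j\<close> the part containing \<open>a\<close> is a multiple of
  \<open>n ^ (i + 1)\<close>; above it, division by \<open>n ^ (j + 1)\<close> discards
  \<open>a\<close>.\<close>

lemma digit_insert_digit_other:
  assumes "i \<noteq> j" "a < n" "a' < n"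
  shows "digit n i (insert_digit n j a r) = digit n i (insert_digit n j a' r)"
proof (cases "i < j")
  case True
  then obtain l where "j = i + 1 + l" using less_iff_Suc_add by auto
  then have nj: "n ^ j = n * n ^ l * n ^ i" by (simp add: power_add)
  have "digit n i ((x * n ^ j) + y) = digit n i y" for x y
  proof -
    have eq: "x * n ^ j + y = y + (x * n ^ l * n) * n ^ i"
      by (simp add: nj mult.commute mult.left_commute)
    show ?thesis unfolding digit_def eq using assms by simp
  qed
  then show ?thesis by (simp add: insert_digit_eq)
next
  case False
  with assms obtain l where i: "i = j + 1 + l" using less_iff_Suc_add by (metis Suc_eq_plus1 add.commute add_Suc_right linorder_neqE_nat plus_1_eq_Suc)
  have "insert_digit n j a r div n ^ i = r div n ^ j div n ^ l" if "a < n" for a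
  proof -
    have "insert_digit n j a r div n ^ i = insert_digit n j a r div n ^ j div n div n ^ l"
      by (simp add: i power_add mult.commute mult.left_commute flip: div_mult2_eq)
    also have "insert_digit n j a r div n ^ j div n = r div n ^ j"
      using that by (simp add: insert_digit_eq)
    finally show ?thesis .
  qed
  with assms show ?thesis by (simp add: digit_def)
qed

lemma insert_digit_less:
  assumes "a < n" "j < k" "r < n ^ (k - 1)"
  shows "insert_digit n j a r < n ^ k"
proof -
  from assms obtain l where k: "k = j + 1 + l" using less_iff_Suc_add by auto
  then have "r < n ^ j * n ^ l" using assms by (simp add: power_add)
  then have "r div n ^ j < n ^ l" by (simp add: less_mult_imp_div_less mult.commute)
  then have "r div n ^ j * n + a < n ^ l * n"
    using \<open>a < n\<close> by (rule mult_add_less)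
  then have "(r div n ^ j * n + a) * n ^ j + r mod n ^ j < n ^ l * n * n ^ j"
    using \<open>a < n\<close> by (intro mult_add_less[of _ "n ^ l * n"]) auto
  then show ?thesis by (simp add: insert_digit_eq k power_add mult.commute mult.left_commute)
qed

lemma insert_digit_surj:
  assumes "c < n ^ k" "j < k"
  obtains r where "r < n ^ (k - 1)" "c = insert_digit n j (digit n j c) r"
proof
  from assms have n: "0 < n" by (cases "n = 0"; cases k) auto
  from assms obtain l where k: "k = j + 1 + l" using less_iff_Suc_add by auto
  \<comment> \<open>Deleting digit \<open>j\<close> of \<open>c\<close> leaves the upper part
    \<open>?h\<close> and the lower part \<open>?l\<close>, which are joined without a gap.\<close>
  let ?h = "c div n ^ j div n" and ?l = "c mod n ^ j"
  let ?r = "?h * n ^ j + ?l"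
  have r: "?r div n ^ j = ?h" "?r mod n ^ j = ?l" using n by auto
  have "?h = c div (n ^ j * n)" by (simp add: div_mult2_eq)
  also have "\<dots> < n ^ l"
    using assms by (intro less_mult_imp_div_less) (simp add: k power_add mult.commute mult.left_commute)
  finally have "?h < n ^ l" .
  then show "?r < n ^ (k - 1)"
    using mult_add_less[of ?h "n ^ l" ?l "n ^ j"] n by (simp add: k power_add mult.commute)
  show "c = insert_digit n j (digit n j c) ?r"
    unfolding insert_digit_eq r digit_def by (simp only: div_mult_mod_eq)
qed

lemma digits_eqI:
  assumes "c < n ^ k" "c' < n ^ k" "\<And>j. j < k \<Longrightarrow> digit n j c = digit n j c'"
  shows "c = c'"
  using assms
proof (induction k arbitrary: c c')
  case (Suc k)
  have "c div n = c' div n"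
  proof (rule Suc.IH)
    show "c div n < n ^ k" "c' div n < n ^ k"
      using Suc.prems by (auto intro!: less_mult_imp_div_less simp: mult.commute)
    show "digit n j (c div n) = digit n j (c' div n)" if "j < k" for j
      using Suc.prems(3)[of "Suc j"] that by (simp add: digit_def div_mult2_eq)
  qed
  moreover have "c mod n = c' mod n"
    using Suc.prems(3)[of 0] by (simp add: digit_def)
  ultimately show ?case by (metis div_mult_mod_eq)
qed simp

definition encode :: "nat \<Rightarrow> (nat \<Rightarrow> nat) \<Rightarrow> nat \<Rightarrow> nat" where
  "encode n u k = (\<Sum>j<k. u j * n ^ j)"

lemma encode_less: "(\<And>j. j < k \<Longrightarrow> u j < n) \<Longrightarrow> encode n u k < n ^ k"
proof (induction k)
  case (Suc k)
  then have "encode n u k < n ^ k" by simp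
  moreover have "u k * n ^ k + n ^ k \<le> n * n ^ k"
    using mult_le_mono1[of "Suc (u k)" n "n ^ k"] Suc.prems[of k] by simp
  ultimately show ?case by (simp add: encode_def)
qed (simp add: encode_def)

lemma digit_encode:
  "(\<And>j. j < k \<Longrightarrow> u j < n) \<Longrightarrow> j < k \<Longrightarrow> digit n j (encode n u k) = u j"
proof (induction k)
  case (Suc k)
  have less: "encode n u k < n ^ k" using Suc.prems by (intro encode_less) auto
  have e: "encode n u (Suc k) = encode n u k + u k * n ^ k" by (simp add: encode_def)
  show ?case
  proof (cases "j = k")
    case True
    moreover have "0 < n" using Suc.prems(1)[of k] by simp
    ultimately show ?thesis using less Suc.prems by (simp add: e digit_def)
  next
    case False
    with Suc.prems have "j < k" by simp
    then obtain l where "k = j + 1 + l" using less_iff_Suc_add by auto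
    then have eq: "u k * n ^ k = (u k * n ^ l * n) * n ^ j" by (simp add: power_add)
    have "digit n j (encode n u (Suc k)) = digit n j (encode n u k)"
      unfolding e digit_def eq using Suc.prems(1)[of k] by simp
    with Suc \<open>j < k\<close> show ?thesis by simp
  qed
qed simp


section \<open>The program\<close>

text \<open>
  Array 4 holds the numbers of unprocessed incoming arcs; arrays 5 and 6 hold linked lists of the
  outgoing arcs, in which arc \<open>e\<close> is represented by \<open>e + 1\<close> and the end of a list by 0; array 7 is
  the queue and finally the sorted arc list. Row \<open>j\<close> of array 8 and of weight array 1, stored at
  \<open>j * n + v\<close>, holds reachability and distance from \<open>s\<^sub>j\<close>. Array 9 marks the tuples found so
  far, encoded in base \<open>n\<close>.
\<close>

definition push_arc :: "wexp \<Rightarrow> com" where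
  "push_arc e = Seq (AssignArr 7 (Var 3) e) (Assign 3 (Add (Var 3) (Const 1)))"

definition build_lists :: com where
  "build_lists = For 2 (Var 1)
     (Seq (AssignArr 4 (Arr 1 (Var 2)) (Add (Arr 4 (Arr 1 (Var 2))) (Const 1)))
     (Seq (AssignArr 6 (Var 2) (Arr 5 (Arr 0 (Var 2))))
          (AssignArr 5 (Arr 0 (Var 2)) (Add (Var 2) (Const 1)))))"

definition push_sources :: com where
  "push_sources = Seq (Assign 3 (Const 0)) (For 2 (Var 1)
     (Cond (Less (Arr 4 (Arr 0 (Var 2))) (Const 1)) (push_arc (Var 2)) Skip))"

definition push_out_arcs :: com where
  "push_out_arcs = Seq (Assign 5 (Arr 5 (Var 4)))
     (While (Less (Const 0) (Var 5))
       (Seq (push_arc (Sub (Var 5) (Const 1)))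
            (Assign 5 (Arr 6 (Sub (Var 5) (Const 1))))))"

text \<open>Variables 2 and 3 are the front and the end of the queue. Entries are never removed, so
  the exhausted queue is the sorted list.\<close>

definition process_queue :: com where
  "process_queue = Seq (Assign 2 (Const 0)) (While (Less (Var 2) (Var 3))
     (Seq (Assign 4 (Arr 1 (Arr 7 (Var 2))))
     (Seq (AssignArr 4 (Var 4) (Sub (Arr 4 (Var 4)) (Const 1)))
     (Seq (Assign 2 (Add (Var 2) (Const 1)))
          (Cond (Less (Arr 4 (Var 4)) (Const 1)) push_out_arcs Skip)))))"

section \<open>Subprograms for the distances\<close>

definition cell :: "nat \<Rightarrow> nat \<Rightarrow> wexp" where
  "cell x a = Add (Mul (Var 6) (Var 0)) (Arr a (Var x))"

definition relax_arcs :: com where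
  "relax_arcs = For 2 (Var 1)
     (Seq (Assign 3 (Arr 7 (Var 2)))
     (Seq (Assign 4 (cell 3 0))
     (Seq (Assign 5 (cell 3 1))
       (Cond (BAnd (Less (Const 0) (Arr 8 (Var 4)))
                   (BNot (BAnd (Less (Const 0) (Arr 8 (Var 5)))
                     (BNot (RLess (RAdd (RArr 1 (Var 4)) (RArr 0 (Var 3))) (RArr 1 (Var 5)))))))
         (Seq (AssignArr 8 (Var 5) (Const 1))
              (AssignWgt 1 (Var 5) (RAdd (RArr 1 (Var 4)) (RArr 0 (Var 3)))))
         Skip))))"

definition all_dists :: "nat \<Rightarrow> com" where
  "all_dists k = For 6 (Const k) (Seq (AssignArr 8 (cell 6 2) (Const 1)) relax_arcs)"

section \<open>Subprograms for routing\<close>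

text \<open>Variable 10 runs through the powers of \<open>n\<close>, and variable 9 lags one behind
  so as to end as \<open>n ^ (k - 1)\<close>.\<close>

definition encode_terminals :: "nat \<Rightarrow> com" where
  "encode_terminals k = Seq (Assign 7 (Const 0)) (Seq (Assign 8 (Const 0)) (Seq (Assign 10 (Const 1))
     (Seq (For 6 (Const k)
        (Seq (Assign 7 (Add (Var 7) (Mul (Arr 2 (Var 6)) (Var 10))))
        (Seq (Assign 8 (Add (Var 8) (Mul (Arr 3 (Var 6)) (Var 10))))
        (Seq (Assign 9 (Var 10))
             (Assign 10 (Mul (Var 10) (Var 0)))))))
     (AssignArr 9 (Var 7) (Const 1)))))"

definition tuple_code :: "nat \<Rightarrow> wexp" where
  "tuple_code a = Add (Add (Mul (Div (Var 11) (Var 10)) (Mul (Var 10) (Var 0))) (Mod (Var 11) (Var 10)))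
     (Mul (Arr a (Var 3)) (Var 10))"

text \<open>A code is moved only if its mark is older than the stamp \<open>i + 2\<close> of the
  current arc; this keeps an arc from being used twice.\<close>

definition move_along :: com where
  "move_along = For 11 (Var 9)
     (Seq (Assign 12 (tuple_code 0))
     (Seq (Assign 13 (tuple_code 1))
       (Cond (BAnd (BAnd (Less (Const 0) (Arr 9 (Var 12)))
                         (Less (Arr 9 (Var 12)) (Add (Var 2) (Const 2))))
                   (Less (Arr 9 (Var 13)) (Const 1)))
         (AssignArr 9 (Var 13) (Add (Var 2) (Const 2)))
         Skip)))"

definition move_all :: "nat \<Rightarrow> com" where
  "move_all k = Seq (Assign 3 (Arr 7 (Var 2))) (Seq (Assign 10 (Const 1)) (For 6 (Const k)
     (Seq (Assign 4 (cell 3 0))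
     (Seq (Assign 5 (cell 3 1))
     (Seq (Cond (BAnd (Less (Const 0) (Arr 8 (Var 4)))
                      (BNot (RLess (RArr 1 (Var 5)) (RAdd (RArr 1 (Var 4)) (RArr 0 (Var 3))))))
            move_along Skip)
          (Assign 10 (Mul (Var 10) (Var 0))))))))"

definition route_terminals :: "nat \<Rightarrow> com" where
  "route_terminals k = Seq (all_dists k) (Seq (encode_terminals k) (Seq (For 2 (Var 1) (move_all k))
     (Cond (Less (Const 0) (Arr 9 (Var 8))) (Assign 0 (Const 1)) (Assign 0 (Const 0)))))"

definition edsp_program :: "nat \<Rightarrow> com" where
  "edsp_program k = Seq build_lists (Seq push_sources (Seq process_queue (route_terminals k)))"


section \<open>Sorting the arcs\<close>

text \<open>The content of the list head for \<open>v\<close> once the first \<open>i\<close> arcs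
  have been inserted at the front. Newer arcs come first, so each list is decreasing.\<close>

fun last_out :: "(nat \<Rightarrow> nat) \<Rightarrow> nat \<Rightarrow> nat \<Rightarrow> nat" where
  "last_out ta v 0 = 0"
| "last_out ta v (Suc i) = (if ta i = v then Suc i else last_out ta v i)"

lemma last_out_le: "last_out ta v i \<le> i"
  by (induction i) (auto intro: le_SucI)

lemma last_out_tail: "last_out ta v i = Suc e \<Longrightarrow> ta e = v"
  by (induction i) (auto split: if_splits)

lemma last_out_greatest: "e < i \<Longrightarrow> ta e = v \<Longrightarrow> e < last_out ta v i"
  by (induction i) (auto simp: less_Suc_eq)

lemma bij_betw_push:
  "bij_betw f {..<q} X \<Longrightarrow> e \<notin> X \<Longrightarrow> bij_betw (f(q := e)) {..<Suc q} (insert e X)"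
  by (auto simp: bij_betw_def inj_on_def lessThan_Suc image_iff)

lemma card_less_Suc:
  "card {e. e < Suc i \<and> P e} = card {e. e < i \<and> P e} + (if P i then 1 else 0)"
proof -
  have "{e. e < Suc i \<and> P e} = (if P i then insert i {e. e < i \<and> P e} else {e. e < i \<and> P e})"
    by (auto simp: less_Suc_eq)
  then show ?thesis by simp
qed

text \<open>The exponent \<open>k + 3\<close> makes room for tuple codes below \<open>n ^ k\<close>,
  table cells below \<open>k * n\<close> and stamps up to \<open>m + 1\<close>.\<close>

locale edsp_instance =
  fixes G :: "(nat, nat) pre_digraph" and w :: "nat \<Rightarrow> real" and s t :: "nat \<Rightarrow> nat"
    and n m k b :: nat
  assumes verts: "verts G = {..<n}" and arcs: "arcs G = {..<m}"
    and dag: "weighted_dag G w"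
    and terminals: "j < k \<Longrightarrow> s j < n" "j < k \<Longrightarrow> t j < n"
    and k_pos: "1 \<le> k" and word: "(n + 2) ^ (k + 3) \<le> 2 ^ b"
begin

sublocale digraph G
  using dag by (simp add: weighted_dag_def)

lemma acyclic: "\<nexists>c. cycle c"
  using dag by (simp add: weighted_dag_def)

lemma tail_less [simp]: "e < m \<Longrightarrow> tail G e < n"
  using tail_in_verts[of e] by (simp add: verts arcs)

lemma head_less [simp]: "e < m \<Longrightarrow> head G e < n"
  using head_in_verts[of e] by (simp add: verts arcs)

section \<open>Quantities that fit into a word\<close>

lemma n_pos: "0 < n"
  using terminals(1)[of 0] k_pos by simp

text \<open>Without parallel arcs, an arc is determined by its pair of end points.\<close>

lemma m_le: "m \<le> n * n"
proof -
  have "card (arc_to_ends G ` {..<m}) \<le> card ({..<n} \<times> {..<n})"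
    by (intro card_mono) (auto simp: arc_to_ends_def)
  then show ?thesis
    using card_image[OF inj_on_arc_to_ends] by (simp add: arcs)
qed

lemma word_m: "m + 2 < 2 ^ b"
proof -
  have "m + 2 < (n + 2) ^ 2" using m_le n_pos by (simp add: power2_eq_square)
  also have "\<dots> \<le> (n + 2) ^ (k + 3)" by (intro power_increasing) auto
  finally show ?thesis using word by simp
qed

lemma word_pow: "j \<le> k \<Longrightarrow> n ^ j < 2 ^ b"
proof -
  assume "j \<le> k"
  have "n ^ j \<le> (n + 2) ^ j" by (intro power_mono) auto
  also have "\<dots> < (n + 2) ^ Suc j" by (intro power_strict_increasing) auto
  also have "\<dots> \<le> (n + 2) ^ (k + 3)" using \<open>j \<le> k\<close> by (intro power_increasing) auto
  finally show ?thesis using word by simp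
qed

lemma word_row: "k * n < 2 ^ b"
proof -
  \<comment> \<open>As \<open>n + 2 \<ge> 2\<close>, the power \<open>(n + 2) ^ k\<close> absorbs
    the constant factor \<open>k\<close> even for small \<open>n\<close>.\<close>
  have "k < 2 ^ k" by simp
  also have "\<dots> \<le> (n + 2) ^ k" by (intro power_mono) auto
  finally have "k * n < (n + 2) ^ k * (n + 2)" by (intro mult_strict_mono) auto
  also have "\<dots> = (n + 2) ^ (k + 1)" by simp
  also have "\<dots> \<le> (n + 2) ^ (k + 3)" by (intro power_increasing) auto
  finally show ?thesis using word by simp
qed

lemma word_k: "k < 2 ^ b"
  using word_row n_pos by (metis dual_order.strict_trans2 le_eq_less_or_eq mult_le_mono2 nat_mult_1_right Suc_leI One_nat_def)

lemma b_pos [simp]: "0 < b" "b \<noteq> 0"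
  using word_m by (cases b; simp)+

lemma m_word [simp]: "x \<le> Suc m \<Longrightarrow> x mod 2 ^ b = x"
  using word_m by simp

text \<open>The input is described separately for each state component, so that an update of one
  component leaves the other two conditions unchanged.\<close>

definition input_vars :: "(nat \<Rightarrow> nat) \<Rightarrow> bool" where
  "input_vars V \<longleftrightarrow> V 0 = n \<and> V 1 = m"

definition input_arrs :: "(nat \<Rightarrow> nat \<Rightarrow> nat) \<Rightarrow> bool" where
  "input_arrs A \<longleftrightarrow> (\<forall>e<m. A 0 e = tail G e \<and> A 1 e = head G e) \<and> (\<forall>j<k. A 2 j = s j \<and> A 3 j = t j)"

definition input_wgts :: "(nat \<Rightarrow> nat \<Rightarrow> real) \<Rightarrow> bool" where
  "input_wgts W \<longleftrightarrow> (\<forall>e<m. W 0 e = w e)"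

definition inp :: "state \<Rightarrow> bool" where
  "inp \<sigma> \<longleftrightarrow> input_vars (var \<sigma>) \<and> input_arrs (arr \<sigma>) \<and> input_wgts (wgt \<sigma>)"

lemma inp_simps [simp]:
  "inp \<sigma> \<Longrightarrow> var \<sigma> 0 = n" "inp \<sigma> \<Longrightarrow> var \<sigma> (Suc 0) = m"
  "inp \<sigma> \<Longrightarrow> e < m \<Longrightarrow> arr \<sigma> 0 e = tail G e"
  "inp \<sigma> \<Longrightarrow> e < m \<Longrightarrow> arr \<sigma> (Suc 0) e = head G e"
  "inp \<sigma> \<Longrightarrow> j < k \<Longrightarrow> arr \<sigma> 2 j = s j"
  "inp \<sigma> \<Longrightarrow> j < k \<Longrightarrow> arr \<sigma> 3 j = t j"
  "inp \<sigma> \<Longrightarrow> e < m \<Longrightarrow> wgt \<sigma> 0 e = w e"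
  by (auto simp: inp_def input_vars_def input_arrs_def input_wgts_def)

lemma input_update [simp]:
  "input_vars V \<Longrightarrow> 1 < x \<Longrightarrow> input_vars (V(x := y))"
  "input_arrs A \<Longrightarrow> 3 < x \<Longrightarrow> input_arrs (A(x := f))"
  "input_wgts W \<Longrightarrow> 0 < x \<Longrightarrow> input_wgts (W(x := g))"
  by (auto simp: input_vars_def input_arrs_def input_wgts_def)

lemma inp_update [simp]:
  "inp (\<sigma>\<lparr>var := V\<rparr>) \<longleftrightarrow> input_vars V \<and> input_arrs (arr \<sigma>) \<and> input_wgts (wgt \<sigma>)"
  "inp (\<sigma>\<lparr>arr := A\<rparr>) \<longleftrightarrow> input_vars (var \<sigma>) \<and> input_arrs A \<and> input_wgts (wgt \<sigma>)"
  "inp (\<sigma>\<lparr>wgt := W\<rparr>) \<longleftrightarrow> input_vars (var \<sigma>) \<and> input_arrs (arr \<sigma>) \<and> input_wgts W"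
  by (auto simp: inp_def)

lemma inp_components [simp]:
  "inp \<sigma> \<Longrightarrow> input_vars (var \<sigma>)" "inp \<sigma> \<Longrightarrow> input_arrs (arr \<sigma>)" "inp \<sigma> \<Longrightarrow> input_wgts (wgt \<sigma>)"
  by (auto simp: inp_def)

text \<open>The storage of the later stages, which sorting hands over still zero.\<close>

definition clean :: "state \<Rightarrow> bool" where
  "clean \<sigma> \<longleftrightarrow> arr \<sigma> 8 = (\<lambda>_. 0) \<and> arr \<sigma> 9 = (\<lambda>_. 0) \<and> wgt \<sigma> 1 = (\<lambda>_. 0)"

abbreviation out_list :: "nat \<Rightarrow> nat \<Rightarrow> nat" where
  "out_list \<equiv> last_out (tail G)"

definition lists :: "state \<Rightarrow> bool" where
  "lists \<sigma> \<longleftrightarrow> (\<forall>v. arr \<sigma> 5 v = out_list v m) \<and> (\<forall>e<m. arr \<sigma> 6 e = out_list (tail G e) e)"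

lemma build_lists_correct:
  assumes "inp \<sigma>" "clean \<sigma>" "arr \<sigma> 4 = (\<lambda>_. 0)" "arr \<sigma> 5 = (\<lambda>_. 0)"
  shows "wp b build_lists (\<lambda>T \<tau>. T \<le> 2 + m * 5 \<and> inp \<tau> \<and> clean \<tau> \<and> lists \<tau> \<and>
    (\<forall>v. arr \<tau> 4 v = card {e. e < m \<and> head G e = v})) \<sigma>"
  unfolding build_lists_def
proof (rule wp_For[where N = m and t = 3 and J = "\<lambda>i \<rho>. inp \<rho> \<and> clean \<rho> \<and>
      (\<forall>v. arr \<rho> 5 v = out_list v i) \<and> (\<forall>e<i. arr \<rho> 6 e = out_list (tail G e) e) \<and>
      (\<forall>v. arr \<rho> 4 v = card {e. e < i \<and> head G e = v})"], goal_cases)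
  case (4 i \<rho>)
  \<comment> \<open>In-degrees never exceed \<open>m\<close>, so counting them cannot
    overflow.\<close>
  have "card {e. e < i \<and> head G e = v} \<le> card {..<m}" for v
    using \<open>i < m\<close> by (intro card_mono) auto
  then have "Suc (card {e. e < i \<and> head G e = v}) \<le> Suc m" for v
    by simp
  with 4 show ?case
    by (auto simp: clean_def card_less_Suc elim: less_SucE)
qed (use assms word_m in \<open>auto simp: clean_def lists_def\<close>)

section \<open>Kahn's algorithm on arcs\<close>

definition avail :: "nat set \<Rightarrow> nat set" where
  "avail D = {e. e < m \<and> (\<forall>f<m. head G f = tail G e \<longrightarrow> f \<in> D)}"

definition pending :: "nat set \<Rightarrow> nat \<Rightarrow> nat set" where
  "pending D v = {e. e < m \<and> head G e = v \<and> e \<notin> D}"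

text \<open>\<open>i\<close> is the front and \<open>q\<close> the end of the queue. The last
  conjunct covers all queued arcs, processed or not; once the queue is exhausted it provides the
  topological order.\<close>

definition kahn :: "nat \<Rightarrow> nat \<Rightarrow> (nat \<Rightarrow> nat) \<Rightarrow> bool" where
  "kahn i q f \<longleftrightarrow> i \<le> q \<and> bij_betw f {..<q} (avail (f ` {..<i})) \<and>
     (\<forall>y<q. \<forall>e<m. head G e = tail G (f y) \<longrightarrow> e \<in> f ` {..<y})"

lemma pending_iff: "card (pending D v) = 0 \<longleftrightarrow> (\<forall>e<m. head G e = v \<longrightarrow> e \<in> D)"
proof -
  have "finite (pending D v)" by (simp add: pending_def)
  then show ?thesis by (auto simp: pending_def)
qed

lemma pending_insert:
  "card (pending (insert e D) v) = card (pending D v) - (if e < m \<and> e \<notin> D \<and> head G e = v then 1 else 0)"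
proof -
  have "pending (insert e D) v = pending D v - {e}" by (auto simp: pending_def)
  moreover have "e \<in> pending D v \<longleftrightarrow> e < m \<and> e \<notin> D \<and> head G e = v" by (auto simp: pending_def)
  moreover have "finite (pending D v)" by (simp add: pending_def)
  ultimately show ?thesis by (simp add: card_Diff_singleton_if)
qed

lemma card_le_if_bij_betw: "bij_betw f {..<q} X \<Longrightarrow> X \<subseteq> {..<m} \<Longrightarrow> q \<le> m"
  using card_mono[of "{..<m}" X] by (auto dest: bij_betw_same_card)

lemma avail_subset: "avail D \<subseteq> {..<m}"
  by (auto simp: avail_def)

lemma push_sources_correct:
  assumes "inp \<sigma>" "clean \<sigma>" "lists \<sigma>" and deg: "\<forall>v. arr \<sigma> 4 v = card (pending {} v)"
  shows "wp b push_sources (\<lambda>T \<tau>. T \<le> 3 + m * 5 \<and> inp \<tau> \<and> clean \<tau> \<and> lists \<tau> \<and>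
    (\<forall>v. arr \<tau> 4 v = card (pending {} v)) \<and> kahn 0 (var \<tau> 3) (arr \<tau> 7)) \<sigma>"
  unfolding push_sources_def wp_Seq wp_Assign
proof (rule wp_For[where N = m and t = 3 and J = "\<lambda>i \<rho>. inp \<rho> \<and> clean \<rho> \<and> lists \<rho> \<and>
      (\<forall>v. arr \<rho> 4 v = card (pending {} v)) \<and>
      bij_betw (arr \<rho> 7) {..<var \<rho> 3} {e. e < i \<and> e \<in> avail {}}"], goal_cases)
  case (4 i \<rho>)
  have "var \<rho> 3 \<le> m"
    using 4 avail_subset[of "{}"] by (intro card_le_if_bij_betw[of "arr \<rho> 7" _ "{e. e < i \<and> e \<in> avail {}}"]) auto
  moreover have src: "card (pending {} (tail G i)) = 0 \<longleftrightarrow> i \<in> avail {}"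
    using \<open>i < m\<close> unfolding pending_iff by (auto simp: avail_def)
  moreover have "{e. e < Suc i \<and> e \<in> avail {}} =
      (if i \<in> avail {} then insert i {e. e < i \<and> e \<in> avail {}} else {e. e < i \<and> e \<in> avail {}})"
    by (auto simp: less_Suc_eq)
  ultimately show ?case
    using 4 by (auto simp: clean_def lists_def push_arc_def intro!: bij_betw_push)
next
  case (5 T \<tau>)
  then have "{e. e < m \<and> e \<in> avail {}} = avail {}" by (auto simp: avail_def)
  with 5 show ?case by (auto simp: kahn_def avail_def bij_betw_def)
qed (use assms word_m in \<open>auto simp: clean_def lists_def bij_betw_def\<close>)

text \<open>Processing \<open>f\<close> affects only arcs leaving its head. They all wait for the
  same arcs, so they become available together, when the last of those is processed.\<close>

lemma avail_insert:
  assumes "f < m" "f \<notin> D"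
  shows "avail (insert f D) =
    (if card (pending (insert f D) (head G f)) = 0
     then avail D \<union> {e. e < m \<and> tail G e = head G f} else avail D)"
proof (cases "\<forall>e<m. head G e = head G f \<longrightarrow> e \<in> insert f D")
  case True
  then show ?thesis unfolding pending_iff avail_def by auto
next
  case False
  then obtain e where "e < m" "head G e = head G f" "e \<notin> insert f D" by blast
  then have "tail G x \<noteq> head G f" if "x \<in> avail (insert f D)" for x
    using that by (force simp: avail_def)
  then have "avail (insert f D) = avail D" by (fastforce simp: avail_def)
  with False show ?thesis unfolding pending_iff by auto
qed

text \<open>The unprocessed \<open>f\<close> itself blocks every arc leaving its head. Arcs pushed
  on account of \<open>f\<close> are thus not yet in the queue.\<close>

lemma avail_new: "f < m \<Longrightarrow> f \<notin> D \<Longrightarrow> e \<in> avail D \<Longrightarrow> tail G e \<noteq> head G f"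
  by (auto simp: avail_def)

lemma push_out_arcs_correct:
  fixes \<sigma> h q X
  assumes "inp \<sigma>" "clean \<sigma>" "lists \<sigma>" and h: "var \<sigma> 4 = h" and q: "var \<sigma> 3 = q"
    and bij: "bij_betw (arr \<sigma> 7) {..<q} X" and X: "X \<subseteq> {..<m}"
    and new: "\<And>e. e \<in> X \<Longrightarrow> tail G e \<noteq> h"
  shows "wp b push_out_arcs (\<lambda>T \<tau>. T + (m - var \<tau> 3) * 4 \<le> 2 + (m - q) * 4 \<and>
    inp \<tau> \<and> clean \<tau> \<and> lists \<tau> \<and> arr \<tau> 4 = arr \<sigma> 4 \<and> var \<tau> 2 = var \<sigma> 2 \<and> q \<le> var \<tau> 3 \<and>
    bij_betw (arr \<tau> 7) {..<var \<tau> 3} (X \<union> {e. e < m \<and> tail G e = h}) \<and>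
    (\<forall>x<q. arr \<tau> 7 x = arr \<sigma> 7 x) \<and> (\<forall>x<var \<tau> 3. q \<le> x \<longrightarrow> tail G (arr \<tau> 7 x) = h)) \<sigma>"
proof -
  \<comment> \<open>\<open>p\<close> is the list pointer. Lists are decreasing and \<open>e\<close>
    is stored as \<open>e + 1\<close>, so the arcs already pushed are those numbered
    \<open>p\<close> or more; the end mark 0 means all of them.\<close>
  let ?X = "\<lambda>p. X \<union> {e. e < m \<and> p \<le> e \<and> tail G e = h}"
  show ?thesis
    unfolding push_out_arcs_def wp_Seq wp_Assign
  proof (rule wp_While[where \<mu> = "\<lambda>\<rho>. (m - var \<rho> 3) * 4" and
        I = "\<lambda>\<rho>. inp \<rho> \<and> clean \<rho> \<and> lists \<rho> \<and> arr \<rho> 4 = arr \<sigma> 4 \<and> var \<rho> 2 = var \<sigma> 2 \<and>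
          q \<le> var \<rho> 3 \<and> bij_betw (arr \<rho> 7) {..<var \<rho> 3} (?X (var \<rho> 5)) \<and>
          (\<forall>x<q. arr \<rho> 7 x = arr \<sigma> 7 x) \<and> (\<forall>x<var \<rho> 3. q \<le> x \<longrightarrow> tail G (arr \<rho> 7 x) = h) \<and>
          var \<rho> 5 \<le> m \<and> (\<forall>e. var \<rho> 5 = Suc e \<longrightarrow> tail G e = h)"], goal_cases)
    case 1
    have "?X (out_list h m) = X"
      using last_out_greatest[of _ m "tail G" h] by force
    moreover have "tail G e = h" if "out_list h m = Suc e" for e
      using last_out_tail[OF that] .
    ultimately show ?case
      using assms by (simp add: clean_def lists_def last_out_le)
  next
    case (2 \<rho>)
    then obtain e where e: "var \<rho> 5 = Suc e" by (cases "var \<rho> 5") auto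
    with 2 have em: "e < m" and te: "tail G e = h" by auto
    define p where "p = out_list h e"
    have p: "p \<le> e" "\<And>f. p = Suc f \<Longrightarrow> tail G f = h" "\<And>f. f < e \<Longrightarrow> tail G f = h \<Longrightarrow> f < p"
      unfolding p_def by (rule last_out_le, erule last_out_tail, erule (1) last_out_greatest)
    have "Suc e \<le> f" if "p \<le> f" "tail G f = h" "f \<noteq> e" for f
      using p(3)[of f] that by linarith
    then have ins: "?X p = insert e (?X (Suc e))"
      using em te p(1) by auto
    have notin: "e \<notin> ?X (Suc e)" using new te by auto
    have "bij_betw (arr \<rho> 7) {..<var \<rho> 3} (?X (Suc e))" using 2 e by simp
    from bij_betw_push[OF this notin]
    have bij': "bij_betw ((arr \<rho> 7)(var \<rho> 3 := e)) {..<Suc (var \<rho> 3)} (?X p)"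
      by (simp only: ins)
    then have q_less: "Suc (var \<rho> 3) \<le> m"
      using X by (intro card_le_if_bij_betw[OF bij']) auto
    have nxt: "arr \<rho> 6 e = p" using 2 em te by (simp add: lists_def p_def)
    \<comment> \<open>One test, the two assignments of \<open>push_arc\<close> and the pointer move
      make four steps, paid by the growth of the queue; \<open>q_less\<close> keeps the truncated
      subtraction exact.\<close>
    have cost: "4 + (m - Suc (var \<rho> 3)) * 4 \<le> (m - var \<rho> 3) * 4" using q_less by simp
    show ?case
      using 2 e em te p q_less bij' nxt cost
      by (auto simp: push_arc_def clean_def lists_def less_Suc_eq)
  next
    case (3 T \<tau>)
    then have "?X (var \<tau> 5) = X \<union> {e. e < m \<and> tail G e = h}" by auto
    with 3 q show ?case by auto
  qed
qed

lemma kahn_skip: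
  assumes "kahn i q f" "i < q" "card (pending (insert (f i) (f ` {..<i})) (head G (f i))) \<noteq> 0"
  shows "kahn (Suc i) q f"
proof -
  have bij: "bij_betw f {..<q} (avail (f ` {..<i}))" using assms by (simp add: kahn_def)
  then have "f i < m" "f i \<notin> f ` {..<i}"
    using \<open>i < q\<close> avail_subset by (fastforce simp: bij_betw_def inj_on_def)+
  from avail_insert[OF this] assms show ?thesis
    by (auto simp: kahn_def lessThan_Suc)
qed

lemma kahn_push:
  assumes "kahn i q f" "i < q" "card (pending (insert (f i) (f ` {..<i})) (head G (f i))) = 0"
    and bij: "bij_betw f' {..<q'} (avail (f ` {..<i}) \<union> {e. e < m \<and> tail G e = head G (f i)})"
    and "q \<le> q'" and same: "\<forall>x<q. f' x = f x"
    and new: "\<forall>x<q'. q \<le> x \<longrightarrow> tail G (f' x) = head G (f i)"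
  shows "kahn (Suc i) q' f'"
proof -
  have "bij_betw f {..<q} (avail (f ` {..<i}))" using assms by (simp add: kahn_def)
  then have "f i < m" "f i \<notin> f ` {..<i}"
    using \<open>i < q\<close> avail_subset by (fastforce simp: bij_betw_def inj_on_def)+
  note av = avail_insert[OF this]
  have img: "f' ` {..<y} = f ` {..<y}" if "y \<le> q" for y
    using same that by auto
  have D': "insert (f i) (f ` {..<i}) = f' ` {..<Suc i}"
    using img[of "Suc i"] \<open>i < q\<close> by (simp add: lessThan_Suc)
  have mono: "e \<in> f' ` {..<y}" if "y < q'" "e < m" "head G e = tail G (f' y)" for y e
  proof (cases "y < q")
    case True
    with that same assms(1) have "e \<in> f ` {..<y}" by (simp add: kahn_def)
    with True img[of y] show ?thesis by simp
  next
    case False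
    \<comment> \<open>A newly pushed arc leaves the head of \<open>f i\<close>; all arcs entering
      there are processed and so sit at positions at most \<open>i < q \<le> y\<close>.\<close>
    with that new have "head G e = head G (f i)" by simp
    with assms(3) \<open>e < m\<close> have "e \<in> insert (f i) (f ` {..<i})" unfolding pending_iff by simp
    then have "e \<in> f' ` {..<Suc i}" by (simp only: D')
    then show ?thesis using False \<open>i < q\<close> by (auto simp: less_Suc_eq)
  qed
  have "avail (f' ` {..<Suc i}) = avail (f ` {..<i}) \<union> {e. e < m \<and> tail G e = head G (f i)}"
    unfolding D'[symmetric] av using assms(3) by simp
  then show ?thesis
    unfolding kahn_def using bij mono \<open>i < q\<close> \<open>q \<le> q'\<close> by simp
qed

lemma wf_arcs: "wf (arcs_ends G)"
proof (rule finite_acyclic_wf)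
  show "finite (arcs_ends G)" by (simp add: arcs_ends_def)
  show "Transitive_Closure.acyclic (arcs_ends G)"
    unfolding Transitive_Closure.acyclic_def
  proof (intro allI notI)
    fix u assume "(u, u) \<in> (arcs_ends G)\<^sup>+"
    then obtain p where "awalk u p u" "p \<noteq> []" using reachable1_awalk by blast
    then have "closed_w p" by (auto simp: closed_w_def)
    with closed_w_imp_cycle acyclic show False by blast
  qed
qed

text \<open>When the front meets the end, all available arcs are processed. By well-founded
  induction over vertices every arc is: if those entering a vertex are processed, those leaving it
  are available.\<close>

lemma kahn_finished:
  assumes "kahn q q f"
  shows "q = m" "arc_order G m f"
proof -
  define D where "D = f ` {..<q}"
  have bij: "bij_betw f {..<q} (avail D)"
    and mono: "\<And>y e. y < q \<Longrightarrow> e < m \<Longrightarrow> head G e = tail G (f y) \<Longrightarrow> e \<in> f ` {..<y}"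
    using assms by (auto simp: kahn_def D_def)
  then have D: "D = avail D" by (simp add: D_def bij_betw_def)
  have "\<forall>e<m. tail G e = v \<longrightarrow> e \<in> D" for v
    using wf_arcs
  proof (induction v rule: wf_induct_rule)
    case (less v)
    have "f \<in> D" if "f < m" "head G f = v" for f
      using less[of "tail G f"] that by (auto simp: arcs_ends_conv arcs)
    then have "e \<in> avail D" if "e < m" "tail G e = v" for e
      using that by (auto simp: avail_def)
    with D show ?case by blast
  qed
  then have "avail D = {..<m}" using D avail_subset by blast
  with bij have bij_m: "bij_betw f {..<q} {..<m}" by simp
  then show q: "q = m" using bij_betw_same_card by fastforce
  show "arc_order G m f"
  proof
    show "bij_betw f {..<m} (arcs G)" using bij_m q by (simp add: arcs)
    fix x y assume xy: "x < m" "y < m" "head G (f x) = tail G (f y)"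
    moreover have "f x < m" using bij_m xy q by (auto simp: bij_betw_def)
    ultimately have "f x \<in> f ` {..<y}" using mono q by simp
    then obtain z where "z < y" "f x = f z" by blast
    moreover have "inj_on f {..<m}" using bij_m q by (simp add: bij_betw_def)
    ultimately show "x < y" using xy by (auto dest: inj_onD)
  qed
qed

lemma process_queue_correct:
  assumes "inp \<sigma>" "clean \<sigma>" "lists \<sigma>" and deg: "\<forall>v. arr \<sigma> 4 v = card (pending {} v)"
    and "kahn 0 (var \<sigma> 3) (arr \<sigma> 7)"
  shows "wp b process_queue (\<lambda>T \<tau>. T \<le> 2 + m * 14 \<and> inp \<tau> \<and> clean \<tau> \<and> arc_order G m (arr \<tau> 7)) \<sigma>"
  unfolding process_queue_def wp_Seq wp_Assign
\<comment> \<open>Amortised charge: 4 steps for an arc entering the queue and 10 for one leaving it,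
  the latter covering its round apart from the pushes.\<close>
proof (rule wp_While[where \<mu> = "\<lambda>\<rho>. (m - var \<rho> 2) * 10 + (m - var \<rho> 3) * 4" and
      I = "\<lambda>\<rho>. inp \<rho> \<and> clean \<rho> \<and> lists \<rho> \<and> kahn (var \<rho> 2) (var \<rho> 3) (arr \<rho> 7) \<and>
        (\<forall>v. arr \<rho> 4 v = card (pending (arr \<rho> 7 ` {..<var \<rho> 2}) v))"], goal_cases)
  case 1
  then show ?case using assms by (auto simp: clean_def lists_def)
next
  case (2 \<rho>)
  define i q f where "i = var \<rho> 2" and "q = var \<rho> 3" and "f = arr \<rho> 7"
  define h where "h = head G (f i)"
  from 2 have kahn: "kahn i q f" and deg: "\<And>v. arr \<rho> 4 v = card (pending (f ` {..<i}) v)"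
    and iq: "i < q" by (auto simp: i_def q_def f_def)
  have bij: "bij_betw f {..<q} (avail (f ` {..<i}))" using kahn by (simp add: kahn_def)
  then have qm: "q \<le> m" using card_le_if_bij_betw avail_subset by blast
  have fi: "f i < m" "f i \<notin> f ` {..<i}"
    using bij iq avail_subset by (fastforce simp: bij_betw_def inj_on_def)+
  define D' where "D' = insert (f i) (f ` {..<i})"
  have D': "f ` {..<Suc i} = D'" by (simp add: D'_def lessThan_Suc)
  have pend: "card (pending D' v) = card (pending (f ` {..<i}) v) - (if v = h then Suc 0 else 0)" for v
    using fi by (auto simp: D'_def pending_insert h_def)
  define \<rho>' where "\<rho>' = \<rho>\<lparr>arr := (arr \<rho>)(4 := (arr \<rho> 4)(h := arr \<rho> 4 h - Suc 0)),
    var := (var \<rho>)(4 := h, 2 := Suc i)\<rparr>"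
  have deg': "arr \<rho>' 4 v = card (pending D' v)" for v
    by (simp add: \<rho>'_def pend deg)
  have inv': "inp \<rho>'" "clean \<rho>'" "lists \<rho>'"
    using 2 by (auto simp: \<rho>'_def clean_def lists_def)
  have \<rho>'_simps: "arr \<rho>' 7 = f" "var \<rho>' 3 = q" "var \<rho>' 4 = h" "var \<rho>' 2 = Suc i"
    by (simp_all add: \<rho>'_def f_def q_def)
  let ?Q = "\<lambda>T \<rho>'. (inp \<rho>' \<and> clean \<rho>' \<and> lists \<rho>' \<and> kahn (var \<rho>' 2) (var \<rho>' 3) (arr \<rho>' 7) \<and>
        (\<forall>v. arr \<rho>' 4 v = card (pending (arr \<rho>' 7 ` {..<var \<rho>' 2}) v))) \<and>
      1 + T + ((m - var \<rho>' 2) * 10 + (m - var \<rho>' 3) * 4) \<le> (m - var \<rho> 2) * 10 + (m - var \<rho> 3) * 4"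
  have "m - i = Suc (m - Suc i)" using iq qm by simp
  then have cost: "(m - Suc i) * 10 + 10 = (m - var \<rho> 2) * 10" by (simp add: i_def)
  have "wp b (Cond (Less (Arr 4 (Var 4)) (Const 1)) push_out_arcs Skip) (\<lambda>T. ?Q (1 + (1 + (1 + T)))) \<rho>'"
  proof (cases "card (pending D' h) = 0")
    case False
    with kahn_skip[OF kahn iq] have "kahn (Suc i) q f" by (simp add: D'_def h_def)
    with False inv' cost show ?thesis
      by (simp add: deg' \<rho>'_simps D' q_def[symmetric])
  next
    case True
    have new: "\<And>e. e \<in> avail (f ` {..<i}) \<Longrightarrow> tail G e \<noteq> h"
      using avail_new[OF fi] by (simp add: h_def)
    have bij': "bij_betw (arr \<rho>' 7) {..<q} (avail (f ` {..<i}))"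
      using bij by (simp add: \<rho>'_simps)
    have "wp b push_out_arcs (\<lambda>T. ?Q (1 + (1 + (1 + (1 + T))))) \<rho>'"
    proof (rule wp_conseq[OF push_out_arcs_correct[OF inv' \<rho>'_simps(3,2) bij' avail_subset new]], goal_cases)
      case (2 T \<tau>)
      then have k': "kahn (Suc i) (var \<tau> 3) (arr \<tau> 7)"
        using kahn_push[OF kahn iq] True by (simp add: D'_def h_def \<rho>'_simps)
      have "arr \<tau> 7 ` {..<Suc i} = f ` {..<Suc i}"
        using 2 iq by (intro image_cong) (auto simp: \<rho>'_simps)
      with 2 k' cost deg' show ?case by (simp add: \<rho>'_simps D' q_def[symmetric])
    qed
    with True show ?thesis by (simp add: deg' \<rho>'_simps)
  qed
  moreover have "Suc i \<le> Suc m" using iq qm by simp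
  ultimately show ?case
    using 2 fi by (simp del: wp_Cond add: \<rho>'_def i_def f_def h_def)
next
  case (3 T \<tau>)
  then have "var \<tau> 2 = var \<tau> 3" by (auto simp: kahn_def)
  with 3 have "kahn (var \<tau> 3) (var \<tau> 3) (arr \<tau> 7)" by simp
  from kahn_finished[OF this] 3 show ?case by auto
qed

end


section \<open>Distances and tuples of end points\<close>

locale ordered_edsp_instance = edsp_instance G w s t n m k b + arc_order G m ord
  for G w s t n m k b ord
begin

lemma ord_less [simp]: "i < m \<Longrightarrow> ord i < m"
  using ord_in_arcs[of i] by (simp add: arcs)

section \<open>Rows of the distance table\<close>

lemma row_less: "j < k \<Longrightarrow> v < n \<Longrightarrow> j * n + v < 2 ^ b"
  using mult_add_less[of j k v n] word_row by simp

lemma row_word [simp]: "j < k \<Longrightarrow> v < n \<Longrightarrow> (j * n mod 2 ^ b + v) mod 2 ^ b = j * n + v"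
  using row_less[of j v] by (simp add: mod_simps)

text \<open>Without the guard a row would run on into the cells of the next one.\<close>

definition reach_row :: "(nat \<Rightarrow> nat) \<Rightarrow> nat \<Rightarrow> nat \<Rightarrow> bool" where
  "reach_row A j v \<longleftrightarrow> v < n \<and> 0 < A (j * n + v)"

definition dist_row :: "(nat \<Rightarrow> real) \<Rightarrow> nat \<Rightarrow> nat \<Rightarrow> real" where
  "dist_row W j v = (if v < n then W (j * n + v) else 0)"

lemma row_update:
  assumes "v < n"
  shows "reach_row (A(j * n + v := Suc 0)) j = (reach_row A j)(v := True)"
    and "dist_row (W(j * n + v := x)) j = (dist_row W j)(v := x)"
  using assms by (auto simp: reach_row_def dist_row_def fun_eq_iff)

lemma row_cong:
  assumes "\<And>v. v < n \<Longrightarrow> A' (j * n + v) = A (j * n + v) \<and> W' (j * n + v) = W (j * n + v)"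
  shows "reach_row A' j = reach_row A j" "dist_row W' j = dist_row W j"
  using assms by (auto simp: reach_row_def dist_row_def fun_eq_iff)

definition fresh :: "state \<Rightarrow> bool" where
  "fresh \<sigma> \<longleftrightarrow> inp \<sigma> \<and> arr \<sigma> 7 = ord \<and> arr \<sigma> 9 = (\<lambda>_. 0)"

text \<open>Each round is one application of \<open>dist_upto_Suc\<close>. The last conjunct
  confines all writes to row \<open>j\<close>, so that finished rows keep their distances and later
  rows stay zero.\<close>

lemma relax_arcs_correct:
  assumes "fresh \<sigma>" and j: "var \<sigma> 6 = j" "j < k"
    and D: "dist_upto w (s j) 0 (reach_row (arr \<sigma> 8) j) (dist_row (wgt \<sigma> 1) j)"
  shows "wp b relax_arcs (\<lambda>T \<tau>. T \<le> 2 + m * 8 \<and> fresh \<tau> \<and> var \<tau> 6 = j \<and>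
    dist_upto w (s j) m (reach_row (arr \<tau> 8) j) (dist_row (wgt \<tau> 1) j) \<and>
    (\<forall>x. x < j * n \<or> Suc j * n \<le> x \<longrightarrow> arr \<tau> 8 x = arr \<sigma> 8 x \<and> wgt \<tau> 1 x = wgt \<sigma> 1 x)) \<sigma>"
  unfolding relax_arcs_def
proof (rule wp_For[where N = m and t = 6 and J = "\<lambda>i \<rho>. fresh \<rho> \<and> var \<rho> 6 = j \<and>
      dist_upto w (s j) i (reach_row (arr \<rho> 8) j) (dist_row (wgt \<rho> 1) j) \<and>
      (\<forall>x. x < j * n \<or> Suc j * n \<le> x \<longrightarrow> arr \<rho> 8 x = arr \<sigma> 8 x \<and> wgt \<rho> 1 x = wgt \<sigma> 1 x)"], goal_cases)
  case (4 i \<rho>)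
  define e u v where "e = ord i" and "u = tail G e" and "v = head G e"
  have e: "e < m" "u < n" "v < n" using \<open>i < m\<close> by (simp_all add: e_def u_def v_def)
  have \<rho>: "inp \<rho>" "arr \<rho> 7 = ord" "arr \<rho> 9 = (\<lambda>_. 0)" "var \<rho> 6 = j" "var \<rho> 2 = i"
    using 4 by (auto simp: fresh_def)
  define R d where "R = reach_row (arr \<rho> 8) j" and "d = dist_row (wgt \<rho> 1) j"
  have "dist_upto w (s j) i R d" using 4 by (simp add: R_def d_def)
  note step = dist_upto_Suc[OF \<open>i < m\<close> this, folded e_def, folded u_def v_def]
  have R: "0 < arr \<rho> 8 (j * n + x) \<longleftrightarrow> R x" and d: "wgt \<rho> (Suc 0) (j * n + x) = d x" if "x < n" for x
    using that by (simp_all add: R_def d_def reach_row_def dist_row_def)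
  have upd: "reach_row ((arr \<rho> 8)(j * n + v := Suc 0)) j = R(v := True)"
    "dist_row ((wgt \<rho> (Suc 0))(j * n + v := x)) j = d(v := x)" for x
    using e by (simp_all add: R_def d_def row_update)
  have w: "wgt \<rho> 0 e = w e" using \<rho> e by simp
  have others: "(\<forall>x. x < j * n \<or> Suc j * n \<le> x \<longrightarrow> arr \<rho> 8 x = arr \<sigma> 8 x \<and> wgt \<rho> (Suc 0) x = wgt \<sigma> (Suc 0) x)"
    using 4 by simp
  have tl: "arr \<rho> 0 e = u" and hd: "arr \<rho> (Suc 0) e = v" and oi: "ord i = e"
    using \<rho> e by (simp_all add: u_def v_def e_def)
  have fr: "reach_row (arr \<rho> 8) j = R" "dist_row (wgt \<rho> (Suc 0)) j = d" by (simp_all add: R_def d_def)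
  show ?case
    using step \<rho> e \<open>j < k\<close> others
    by (auto simp: cell_def fresh_def R d w upd tl hd oi fr)
qed (use assms word_m in \<open>auto simp: fresh_def\<close>)

lemma all_dists_correct:
  assumes "fresh \<sigma>" "arr \<sigma> 8 = (\<lambda>_. 0)" "wgt \<sigma> 1 = (\<lambda>_. 0)"
  shows "wp b (all_dists k) (\<lambda>T \<tau>. T \<le> 2 + k * (5 + m * 8) \<and> fresh \<tau> \<and>
    (\<forall>j<k. dist_upto w (s j) m (reach_row (arr \<tau> 8) j) (dist_row (wgt \<tau> 1) j))) \<sigma>"
  unfolding all_dists_def
proof (rule wp_For[where N = k and t = "3 + m * 8" and J = "\<lambda>j \<rho>. fresh \<rho> \<and>
      (\<forall>j'<j. dist_upto w (s j') m (reach_row (arr \<rho> 8) j') (dist_row (wgt \<rho> 1) j')) \<and>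
      (\<forall>x\<ge>j * n. arr \<rho> 8 x = 0 \<and> wgt \<rho> 1 x = 0)"], goal_cases)
  case (4 j \<rho>)
  have sj: "s j < n" using terminals \<open>j < k\<close> by simp
  define \<rho>' where "\<rho>' = \<rho>\<lparr>arr := (arr \<rho>)(8 := (arr \<rho> 8)(j * n + s j := Suc 0))\<rparr>"
  have \<rho>': "fresh \<rho>'" "var \<rho>' 6 = j" using 4 by (auto simp: fresh_def \<rho>'_def)
  have "reach_row (arr \<rho>' 8) j = (\<lambda>v. v = s j)"
    using 4 sj by (auto simp: reach_row_def \<rho>'_def fun_eq_iff)
  \<comment> \<open>The distance of the source is not written here: its cell still holds the initial
    0.\<close>
  moreover have "dist_row (wgt \<rho>' 1) j (s j) = 0"
    using 4 by (simp add: dist_row_def \<rho>'_def)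
  ultimately have D: "dist_upto w (s j) 0 (reach_row (arr \<rho>' 8) j) (dist_row (wgt \<rho>' 1) j)"
    using sj by (simp add: dist_upto_0 verts)
  have "wp b relax_arcs (\<lambda>T \<tau>. 1 + T \<le> 3 + m * 8 \<and> var \<tau> 6 = j \<and> fresh (\<tau>\<lparr>var := (var \<tau>)(6 := Suc j)\<rparr>) \<and>
      (\<forall>j'<Suc j. dist_upto w (s j') m (reach_row (arr \<tau> 8) j') (dist_row (wgt \<tau> 1) j')) \<and>
      (\<forall>x\<ge>Suc j * n. arr \<tau> 8 x = 0 \<and> wgt \<tau> 1 x = 0)) \<rho>'"
  proof (rule wp_conseq[OF relax_arcs_correct[OF \<rho>' \<open>j < k\<close> D]], goal_cases)
    case (1 T \<tau>)
    have same: "arr \<tau> 8 x = arr \<rho> 8 x \<and> wgt \<tau> 1 x = wgt \<rho> 1 x" if "x < j * n \<or> Suc j * n \<le> x" for x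
      using 1 that sj by (auto simp: \<rho>'_def)
    have "dist_upto w (s j') m (reach_row (arr \<tau> 8) j') (dist_row (wgt \<tau> 1) j')" if "j' < j" for j'
    proof -
      have "j' * n + v < j * n" if "v < n" for v
        using mult_add_less[OF \<open>j' < j\<close> that] .
      with same have "reach_row (arr \<tau> 8) j' = reach_row (arr \<rho> 8) j'"
        "dist_row (wgt \<tau> 1) j' = dist_row (wgt \<rho> 1) j'"
        using row_cong[of "arr \<tau> 8" j' "arr \<rho> 8" "wgt \<tau> 1" "wgt \<rho> 1"] by auto
      with 4 that show ?thesis by simp
    qed
    moreover have "arr \<tau> 8 x = 0 \<and> wgt \<tau> 1 x = 0" if "Suc j * n \<le> x" for x
      using same[of x] 4(3) that by simp
    ultimately show ?case
      using 1 by (auto simp: fresh_def less_Suc_eq)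
  qed
  then show ?case
    using 4 sj by (simp add: cell_def fresh_def \<rho>'_def)
qed (use assms word_k in \<open>auto simp: fresh_def\<close>)

text \<open>Routing only reads the distance table, which is therefore frozen as \<open>A\<close> and
  \<open>W\<close>: tightness no longer depends on the state.\<close>

definition ready :: "(nat \<Rightarrow> nat) \<Rightarrow> (nat \<Rightarrow> real) \<Rightarrow> state \<Rightarrow> bool" where
  "ready A W \<sigma> \<longleftrightarrow> inp \<sigma> \<and> arr \<sigma> 7 = ord \<and> arr \<sigma> 8 = A \<and> wgt \<sigma> 1 = W \<and>
     var \<sigma> 8 = encode n t k \<and> var \<sigma> 9 = n ^ (k - 1)"

lemma pow_word [simp]: "j \<le> k \<Longrightarrow> n ^ j mod 2 ^ b = n ^ j"
  using word_pow by simp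

lemma encode_step_word:
  assumes "j < k" "\<And>j. j < k \<Longrightarrow> u j < n"
  shows "(encode n u j + u j * n ^ j mod 2 ^ b) mod 2 ^ b = encode n u (Suc j)"
proof -
  have "encode n u (Suc j) < n ^ Suc j" using assms by (intro encode_less) auto
  also have "\<dots> < 2 ^ b" using assms by (intro word_pow) auto
  finally show ?thesis by (simp add: encode_def mod_simps)
qed

lemma encode_terminals_correct:
  assumes "fresh \<sigma>"
  shows "wp b (encode_terminals k) (\<lambda>T \<tau>. T \<le> 6 + k * 6 \<and> ready (arr \<sigma> 8) (wgt \<sigma> 1) \<tau> \<and>
    arr \<tau> 9 = (\<lambda>_. 0)(encode n s k := 1)) \<sigma>"
  unfolding encode_terminals_def wp_Seq wp_Assign
proof (rule wp_For[where N = k and t = 4 and J = "\<lambda>j \<rho>. fresh \<rho> \<and>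
      arr \<rho> 8 = arr \<sigma> 8 \<and> wgt \<rho> 1 = wgt \<sigma> 1 \<and> var \<rho> 7 = encode n s j \<and> var \<rho> 8 = encode n t j \<and>
      var \<rho> 10 = n ^ j \<and> (0 < j \<longrightarrow> var \<rho> 9 = n ^ (j - 1))"], goal_cases)
  case (4 j \<rho>)
  then have \<rho>: "inp \<rho>" by (simp add: fresh_def)
  have "n ^ j * n mod 2 ^ b = n ^ j * n" using pow_word[of "Suc j"] \<open>j < k\<close> by (simp add: mult.commute)
  with 4 \<rho> encode_step_word[OF \<open>j < k\<close>, of s] encode_step_word[OF \<open>j < k\<close>, of t] terminals
  show ?case by (auto simp: fresh_def)
next
  case (5 T \<tau>)
  with k_pos show ?case by (auto simp: ready_def fresh_def)
qed (use assms word_k in \<open>auto simp: fresh_def encode_def\<close>)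

context
  fixes A :: "nat \<Rightarrow> nat" and W :: "nat \<Rightarrow> real"
begin

section \<open>Codes of the tuples found so far\<close>

abbreviation tight_arc :: "nat \<Rightarrow> nat \<Rightarrow> bool" where
  "tight_arc j \<equiv> tight w (reach_row A j) (dist_row W j)"

definition reachable_codes :: "nat \<Rightarrow> nat set" where
  "reachable_codes i = {c. c < n ^ k \<and> routable k tight_arc s i (\<lambda>j. digit n j c)}"

text \<open>\<open>l\<close> is the progress of the loop over the other coordinates, complete at
  \<open>n ^ (k - 1)\<close>. In \<open>new_codes\<close> it counts the coordinates already
  served.\<close>

definition moved_codes :: "nat \<Rightarrow> nat \<Rightarrow> nat \<Rightarrow> nat set" where
  "moved_codes i j l = {insert_digit n j (head G (ord i)) r | r.
     r < l \<and> insert_digit n j (tail G (ord i)) r \<in> reachable_codes i}"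

definition new_codes :: "nat \<Rightarrow> nat \<Rightarrow> nat set" where
  "new_codes i l = (\<Union>j \<in> {j. j < l \<and> tight_arc j (ord i)}. moved_codes i j (n ^ (k - 1)))"

lemma routable_cong:
  "(\<And>j. j < k \<Longrightarrow> u j = u' j) \<Longrightarrow> routable k T s i u \<longleftrightarrow> routable k T s i u'"
  unfolding routable_def by (intro ex_cong1) auto

lemma reachable_codes_0: "reachable_codes 0 = {encode n s k}"
proof -
  have "(\<forall>j<k. digit n j c = s j) \<longleftrightarrow> c = encode n s k" if "c < n ^ k" for c
    using digits_eqI[of c n k "encode n s k"] encode_less[of k s n] digit_encode[of k s n]
      terminals that by auto
  then show ?thesis
    using encode_less[of k s n] terminals
    by (auto simp: reachable_codes_def routable_0 verts)
qed

text \<open>This is \<open>routable_Suc\<close> for codes: a tuple with the head of the arc in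
  coordinate \<open>j\<close> and its predecessor with the tail there agree elsewhere, so
  \<open>insert_digit\<close> produces both from the same \<open>r\<close>.\<close>

lemma reachable_codes_Suc:
  assumes "i < m"
  shows "reachable_codes (Suc i) = reachable_codes i \<union> new_codes i k"
proof (intro set_eqI)
  fix c
  define a h where "a = tail G (ord i)" and "h = head G (ord i)"
  have ah: "a < n" "h < n" using assms by (simp_all add: a_def h_def)
  have move: "(digit n j c = h \<and> routable k tight_arc s i ((\<lambda>j. digit n j c)(j := a))) \<longleftrightarrow>
      c \<in> moved_codes i j (n ^ (k - 1))" if c: "c < n ^ k" and j: "j < k" for j
  proof
    assume *: "digit n j c = h \<and> routable k tight_arc s i ((\<lambda>j. digit n j c)(j := a))"
    obtain r where r: "r < n ^ (k - 1)" "c = insert_digit n j h r"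
      using insert_digit_surj[OF c j] * by metis
    have "(\<lambda>j. digit n j c)(j := a) = (\<lambda>l. digit n l (insert_digit n j a r))"
      using ah digit_insert_digit_other[of _ j a n h r]
      by (simp add: fun_eq_iff r(2) digit_insert_digit_same)
    with * have "insert_digit n j a r \<in> reachable_codes i"
      using insert_digit_less[OF ah(1) j r(1)] by (simp add: reachable_codes_def)
    with r show "c \<in> moved_codes i j (n ^ (k - 1))"
      by (auto simp: moved_codes_def a_def h_def)
  next
    assume "c \<in> moved_codes i j (n ^ (k - 1))"
    then obtain r where r: "c = insert_digit n j h r" "insert_digit n j a r \<in> reachable_codes i"
      by (auto simp: moved_codes_def a_def h_def)
    have "(\<lambda>j. digit n j c)(j := a) = (\<lambda>l. digit n l (insert_digit n j a r))"
      using ah digit_insert_digit_other[of _ j a n h r]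
      by (simp add: fun_eq_iff r(1) digit_insert_digit_same)
    with r ah show "digit n j c = h \<and> routable k tight_arc s i ((\<lambda>j. digit n j c)(j := a))"
      by (simp add: reachable_codes_def digit_insert_digit_same)
  qed
  have "c < n ^ k" if "c \<in> new_codes i k"
    using that ah insert_digit_less by (auto simp: new_codes_def moved_codes_def a_def h_def)
  then show "c \<in> reachable_codes (Suc i) \<longleftrightarrow> c \<in> reachable_codes i \<union> new_codes i k"
    using move routable_Suc[OF assms, of k tight_arc s "\<lambda>j. digit n j c"]
    by (auto simp: reachable_codes_def new_codes_def a_def h_def)
qed

text \<open>
  Cells first marked at step \<open>i\<close> carry the stamp \<open>i + 2\<close>, so that they are not extended
  again by the same arc.
\<close>

definition marks :: "nat \<Rightarrow> nat set \<Rightarrow> (nat \<Rightarrow> nat) \<Rightarrow> bool" where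
  "marks i X V \<longleftrightarrow> (\<forall>c. V c \<le> i + 2 \<and> (0 < V c \<and> V c < i + 2 \<longleftrightarrow> c \<in> reachable_codes i) \<and>
     (0 < V c \<longleftrightarrow> c \<in> reachable_codes i \<union> X))"

lemma marks_0: "marks 0 {} ((\<lambda>_. 0)(encode n s k := 1))"
  by (simp add: marks_def reachable_codes_0)

text \<open>Advancing \<open>i\<close> raises the threshold above every stamp given so far, so all
  marked codes count as old.\<close>

lemma marks_Suc: "i < m \<Longrightarrow> marks i (new_codes i k) V \<Longrightarrow> marks (Suc i) {} V"
  unfolding marks_def reachable_codes_Suc by (simp add: less_Suc_eq_le le_Suc_eq)

text \<open>Only blank cells are stamped: a new stamp over an older mark would hide a code that the
  current arc may still have to move.\<close>

lemma marks_insert: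
  "marks i X V \<Longrightarrow> marks i (insert c X) (if V c = 0 then V(c := i + 2) else V)"
  unfolding marks_def by (auto; metis not_gr_zero)

lemma moved_codes_Suc:
  "moved_codes i j (Suc r) = (if insert_digit n j (tail G (ord i)) r \<in> reachable_codes i
     then insert (insert_digit n j (head G (ord i)) r) (moved_codes i j r) else moved_codes i j r)"
  by (auto simp: moved_codes_def less_Suc_eq)

text \<open>Reduction modulo \<open>2 ^ b\<close> commutes with sums and products, so it suffices
  that the final code fits into a word.\<close>

lemma insert_digit_word:
  assumes "a < n" "j < k" "r < n ^ (k - 1)"
  shows "(((r div n ^ j * (n ^ j * n mod 2 ^ b)) mod 2 ^ b + r mod n ^ j) mod 2 ^ b
      + a * n ^ j mod 2 ^ b) mod 2 ^ b = insert_digit n j a r"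
proof -
  have "insert_digit n j a r < 2 ^ b"
    using insert_digit_less[OF assms] word_pow[of k] by simp
  then show ?thesis by (simp add: insert_digit_def mod_simps)
qed

lemma move_along_correct:
  assumes "ready A W \<sigma>" and i: "var \<sigma> 2 = i" "i < m" and "var \<sigma> 3 = ord i"
    and j: "var \<sigma> 6 = j" "j < k" and "var \<sigma> 10 = n ^ j" and "marks i X (arr \<sigma> 9)"
  shows "wp b move_along (\<lambda>T \<tau>. T \<le> 2 + n ^ (k - 1) * 6 \<and> ready A W \<tau> \<and> var \<tau> 2 = i \<and>
    var \<tau> 3 = ord i \<and> var \<tau> 6 = j \<and> var \<tau> 10 = n ^ j \<and>
    marks i (X \<union> moved_codes i j (n ^ (k - 1))) (arr \<tau> 9)) \<sigma>"
  unfolding move_along_def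
proof (rule wp_For[where N = "n ^ (k - 1)" and t = 4 and J = "\<lambda>r \<rho>. ready A W \<rho> \<and> var \<rho> 2 = i \<and>
      var \<rho> 3 = ord i \<and> var \<rho> 6 = j \<and> var \<rho> 10 = n ^ j \<and>
      marks i (X \<union> moved_codes i j r) (arr \<rho> 9)"], goal_cases)
  case (4 r \<rho>)
  define e where "e = ord i"
  have e: "e < m" using i by (simp add: e_def)
  have \<rho>: "inp \<rho>" "var \<rho> 2 = i" "var \<rho> 3 = e" "var \<rho> 10 = n ^ j" "var \<rho> 11 = r"
    using 4 by (simp_all add: ready_def e_def)
  define c c' where "c = insert_digit n j (tail G e) r" and "c' = insert_digit n j (head G e) r"
  have code: "weval b \<rho> (tuple_code 0) = c"
    "weval b (\<rho>\<lparr>var := (var \<rho>)(12 := x)\<rparr>) (tuple_code 1) = c'" for x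
    using insert_digit_word[OF tail_less[OF e] j(2) 4(1)] insert_digit_word[OF head_less[OF e] j(2) 4(1)]
      \<rho> e by (simp_all add: tuple_code_def c_def c'_def)
  have stamp: "(i + 2 mod 2 ^ b) mod 2 ^ b = i + 2"
    using i word_m by simp
  have M: "marks i (X \<union> moved_codes i j r) (arr \<rho> 9)" using 4 by simp
  \<comment> \<open>The stamps recover the set of codes from before arc \<open>i\<close>, although
    codes moved along this arc may already be marked.\<close>
  then have mem: "c \<in> reachable_codes i \<longleftrightarrow> 0 < arr \<rho> 9 c \<and> arr \<rho> 9 c < i + 2"
    unfolding marks_def by blast
  have "marks i (X \<union> moved_codes i j (Suc r)) (if 0 < arr \<rho> 9 c \<and> arr \<rho> 9 c < i + 2 \<and> arr \<rho> 9 c' = 0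
      then (arr \<rho> 9)(c' := i + 2) else arr \<rho> 9)"
    using M marks_insert[OF M, of c'] mem
    by (auto simp: moved_codes_Suc c_def c'_def e_def)
  with 4 \<rho> stamp show ?case
    by (auto simp: code[unfolded One_nat_def] ready_def)
next
  case (5 T \<tau>)
  then show ?case by simp
qed (use assms word_pow[of "k - 1"] in \<open>auto simp: ready_def moved_codes_def\<close>)

lemma tight_test:
  assumes "ready A W \<rho>" "j < k" "e < m" "var \<rho> 3 = e"
    "var \<rho> 4 = j * n + tail G e" "var \<rho> 5 = j * n + head G e"
  shows "beval b \<rho> (BAnd (Less (Const 0) (Arr 8 (Var 4)))
      (BNot (RLess (RArr 1 (Var 5)) (RAdd (RArr 1 (Var 4)) (RArr 0 (Var 3)))))) \<longleftrightarrow> tight_arc j e"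
  using assms by (auto simp: ready_def tight_def reach_row_def dist_row_def)

text \<open>Every coordinate is moved from the same set \<open>reachable_codes i\<close>, so the arc
  serves only one of them; the stage advances after the last coordinate.\<close>

lemma move_all_correct:
  assumes "ready A W \<sigma>" and i: "var \<sigma> 2 = i" "i < m" and "marks i {} (arr \<sigma> 9)"
  shows "wp b (move_all k) (\<lambda>T \<tau>. T \<le> 4 + k * (n ^ (k - 1) * 6 + 8) \<and> ready A W \<tau> \<and> var \<tau> 2 = i \<and>
    marks (Suc i) {} (arr \<tau> 9)) \<sigma>"
  unfolding move_all_def wp_Seq wp_Assign
proof (rule wp_For[where N = k and t = "n ^ (k - 1) * 6 + 6" and J = "\<lambda>j \<rho>. ready A W \<rho> \<and> var \<rho> 2 = i \<and>
      var \<rho> 3 = ord i \<and> var \<rho> 10 = n ^ j \<and> marks i (new_codes i j) (arr \<rho> 9)"], goal_cases)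
  case (4 j \<rho>)
  define e where "e = ord i"
  have e: "e < m" using i by (simp add: e_def)
  define \<rho>' where "\<rho>' = \<rho>\<lparr>var := (var \<rho>)(4 := j * n + tail G e, 5 := j * n + head G e)\<rparr>"
  have \<rho>': "ready A W \<rho>'" "var \<rho>' 2 = i" "var \<rho>' 3 = ord i" "var \<rho>' 6 = j" "var \<rho>' 10 = n ^ j"
    "marks i (new_codes i j) (arr \<rho>' 9)"
    using 4 by (auto simp: \<rho>'_def ready_def)
  have pow: "n ^ j * n mod 2 ^ b = n ^ Suc j"
    using pow_word[of "Suc j"] \<open>j < k\<close> by (simp add: mult.commute)
  have new: "new_codes i (Suc j) = (if tight_arc j e
      then new_codes i j \<union> moved_codes i j (n ^ (k - 1)) else new_codes i j)"
    by (auto simp: new_codes_def e_def less_Suc_eq)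
  let ?Q = "\<lambda>T \<tau>. T \<le> n ^ (k - 1) * 6 + 6 \<and> var \<tau> 6 = j \<and> ready A W (\<tau>\<lparr>var := (var \<tau>)(6 := Suc j)\<rparr>) \<and>
    var \<tau> 2 = i \<and> var \<tau> 3 = ord i \<and> var \<tau> 10 = n ^ Suc j \<and> marks i (new_codes i (Suc j)) (arr \<tau> 9)"
  have "wp b (Cond (BAnd (Less (Const 0) (Arr 8 (Var 4)))
      (BNot (RLess (RArr 1 (Var 5)) (RAdd (RArr 1 (Var 4)) (RArr 0 (Var 3)))))) move_along Skip)
    (\<lambda>T. wp b (Assign 10 (Mul (Var 10) (Var 0))) (\<lambda>U. ?Q (1 + (1 + (T + U))))) \<rho>'"
  proof (cases "tight_arc j e")
    case True
    have "wp b move_along (\<lambda>T. wp b (Assign 10 (Mul (Var 10) (Var 0))) (\<lambda>U. ?Q (1 + (1 + ((1 + T) + U))))) \<rho>'"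
      by (rule wp_conseq[OF move_along_correct[OF \<rho>'(1,2) i(2) \<rho>'(3,4) \<open>j < k\<close> \<rho>'(5,6)]])
        (use True pow in \<open>auto simp: new ready_def\<close>)
    moreover have "tight_arc j e \<longleftrightarrow> beval b \<rho>' (BAnd (Less (Const 0) (Arr 8 (Var 4)))
      (BNot (RLess (RArr 1 (Var 5)) (RAdd (RArr 1 (Var 4)) (RArr 0 (Var 3))))))"
      using tight_test[OF \<rho>'(1) \<open>j < k\<close> e] \<rho>'(3) by (simp add: \<rho>'_def e_def)
    ultimately show ?thesis using True unfolding wp_Cond by metis
  next
    case False
    moreover have "tight_arc j e \<longleftrightarrow> beval b \<rho>' (BAnd (Less (Const 0) (Arr 8 (Var 4)))
      (BNot (RLess (RArr 1 (Var 5)) (RAdd (RArr 1 (Var 4)) (RArr 0 (Var 3))))))"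
      using tight_test[OF \<rho>'(1) \<open>j < k\<close> e] \<rho>'(3) by (simp add: \<rho>'_def e_def)
    moreover have "wp b Skip (\<lambda>T. wp b (Assign 10 (Mul (Var 10) (Var 0))) (\<lambda>U. ?Q (1 + (1 + ((1 + T) + U))))) \<rho>'"
      using False \<rho>' pow by (auto simp: new ready_def)
    ultimately show ?thesis unfolding wp_Cond by metis
  qed
  then show ?case
    using 4 e \<rho>'(3) by (simp del: wp_Cond add: cell_def ready_def \<rho>'_def e_def[symmetric])
next
  case (5 T \<tau>)
  with marks_Suc[OF i(2)] show ?case by (auto simp: algebra_simps)
qed (use assms word_k in \<open>auto simp: ready_def new_codes_def\<close>)

end

section \<open>Reading off the answer\<close>

lemma routable_target_iff:
  "encode n t k \<in> reachable_codes A W m \<longleftrightarrow> routable k (tight_arc A W) s m t"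
proof -
  have "routable k (tight_arc A W) s m (\<lambda>j. digit n j (encode n t k)) \<longleftrightarrow> routable k (tight_arc A W) s m t"
    using terminals by (intro routable_cong) (simp add: digit_encode)
  then show ?thesis
    using encode_less[of k t n] terminals by (simp add: reachable_codes_def)
qed

lemma route_terminals_correct:
  assumes "fresh \<sigma>" "arr \<sigma> 8 = (\<lambda>_. 0)" "wgt \<sigma> 1 = (\<lambda>_. 0)"
  shows "wp b (route_terminals k) (\<lambda>T \<tau>.
    T \<le> 12 + k * (11 + m * 8) + m * (6 + k * (n ^ (k - 1) * 6 + 8)) \<and>
    var \<tau> 0 = (if edsp k G w s t then 1 else 0)) \<sigma>"
  unfolding route_terminals_def wp_Seq
proof (rule wp_conseq[OF all_dists_correct[OF assms]], goal_cases)
  case dists: (1 T1 \<sigma>1)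
  define A W where "A = arr \<sigma>1 8" and "W = wgt \<sigma>1 1"
  have D: "dist_upto w (s j) m (reach_row A j) (dist_row W j)" if "j < k" for j
    using dists that by (simp add: A_def W_def)
  have ans: "edsp k G w s t \<longleftrightarrow> encode n t k \<in> reachable_codes A W m"
    unfolding routable_target_iff
    using acyclic D terminals by (intro edsp_iff_routable) (auto simp: verts)
  from dists have "fresh \<sigma>1" by simp
  then show ?case
  proof (rule wp_conseq[OF encode_terminals_correct], goal_cases)
    case enc: (1 T2 \<sigma>2)
    show ?case
    proof (rule wp_For[where N = m and t = "4 + k * (n ^ (k - 1) * 6 + 8)" and
          J = "\<lambda>i \<rho>. ready A W \<rho> \<and> marks A W i {} (arr \<rho> 9)"], goal_cases)
      case (4 i \<rho>)
      then show ?case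
        by (intro wp_conseq[OF move_all_correct[of A W \<rho> i]]) (auto simp: ready_def)
    next
      case (5 T3 \<tau>)
      \<comment> \<open>With the set of new codes empty, being marked and being reachable within all
        \<open>m\<close> arcs coincide.\<close>
      then have "0 < arr \<tau> 9 (var \<tau> 8) \<longleftrightarrow> edsp k G w s t"
        unfolding ans marks_def ready_def by simp
      with 5 dists enc show ?case by (auto simp: algebra_simps)
    qed (use enc word_m marks_0[of A W] in \<open>auto simp: ready_def A_def W_def\<close>)
  qed
qed

end

context edsp_instance
begin

section \<open>Total running time\<close>

lemma inp_edsp_input: "inp (edsp_input k G w s t)" "clean (edsp_input k G w s t)"
  by (auto simp: inp_def clean_def edsp_input_def input_vars_def input_arrs_def input_wgts_def verts arcs)

lemma edsp_program_correct:
  "wp b (edsp_program k) (\<lambda>T \<tau>. T \<le> (31 + 22 * k) * (m * n ^ (k - 1) + 1) \<and>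
     var \<tau> 0 = (if edsp k G w s t then 1 else 0)) (edsp_input k G w s t)"
proof -
  have zero: "arr (edsp_input k G w s t) 4 = (\<lambda>_. 0)" "arr (edsp_input k G w s t) 5 = (\<lambda>_. 0)"
    by (simp_all add: edsp_input_def)
  have bound: "(2 + m * 5) + (3 + m * 5) + (2 + m * 14) + (12 + k * (11 + m * 8)
      + m * (6 + k * (n ^ (k - 1) * 6 + 8))) \<le> (31 + 22 * k) * (m * n ^ (k - 1) + 1)"
  proof -
    \<comment> \<open>\<open>n \<ge> 1\<close> gives \<open>m \<le> M\<close>. The terms in
      \<open>m\<close> alone add up to \<open>5 + 5 + 14 + 6 = 30\<close>, those in
      \<open>k * m\<close> and \<open>k * M\<close> to \<open>8 + 8 + 6 = 22\<close>. The summand 1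
      of the bound pays for the overhead when there are no arcs.\<close>
    define M where "M = m * n ^ (k - 1)"
    have "m \<le> M" using n_pos by (simp add: M_def)
    moreover from this have "k * m \<le> k * M" by simp
    moreover have "m * (6 + k * (n ^ (k - 1) * 6 + 8)) = 6 * m + 6 * (k * M) + 8 * (k * m)"
      by (simp add: M_def distrib_left)
    moreover have "k * (11 + m * 8) = 11 * k + 8 * (k * m)"
      by (simp add: distrib_left)
    moreover have "(31 + 22 * k) * (M + 1) = 31 * M + 31 + 22 * (k * M) + 22 * k"
      by (simp add: distrib_left distrib_right)
    ultimately show ?thesis unfolding M_def[symmetric] by linarith
  qed
  show ?thesis
    unfolding edsp_program_def wp_Seq
  proof (rule wp_conseq[OF build_lists_correct[OF inp_edsp_input zero]], goal_cases)
    case l: (1 T1 \<sigma>1)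
    then have "inp \<sigma>1" "clean \<sigma>1" "lists \<sigma>1" "\<forall>v. arr \<sigma>1 4 v = card (pending {} v)"
      by (auto simp: pending_def)
    then show ?case
    proof (rule wp_conseq[OF push_sources_correct], goal_cases)
      case p: (1 T2 \<sigma>2)
      then have "inp \<sigma>2" "clean \<sigma>2" "lists \<sigma>2" "\<forall>v. arr \<sigma>2 4 v = card (pending {} v)"
        "kahn 0 (var \<sigma>2 3) (arr \<sigma>2 7)" by auto
      then show ?case
      proof (rule wp_conseq[OF process_queue_correct], goal_cases)
        case q: (1 T3 \<sigma>3)
        \<comment> \<open>The order is known only now: it is the content of array 7 after
          sorting.\<close>
        then interpret arc_order G m "arr \<sigma>3 7" by simp
        interpret ordered_edsp_instance G w s t n m k b "arr \<sigma>3 7" ..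
        have "fresh \<sigma>3" "arr \<sigma>3 8 = (\<lambda>_. 0)" "wgt \<sigma>3 1 = (\<lambda>_. 0)"
          using q by (auto simp: fresh_def clean_def)
        then show ?case
          by (rule wp_conseq[OF route_terminals_correct]) (use l p q bound in auto)
      qed
    qed
  qed
qed

end

theorem theorem5:
  fixes k :: nat
  assumes "k \<ge> 1"
  shows "\<exists>c d C. solves_edsp_dag k c d (\<lambda>n m. C * (m * n ^ (k - 1) + 1))"
proof (intro exI)
  show "solves_edsp_dag k (edsp_program k) (k + 3) (\<lambda>n m. (31 + 22 * k) * (m * n ^ (k - 1) + 1))"
    unfolding solves_edsp_dag_def
  proof (intro allI impI)
    fix n m b :: nat and G :: "(nat, nat) pre_digraph" and w :: "nat \<Rightarrow> real" and s t :: "nat \<Rightarrow> nat"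
    assume "verts G = {..<n}" "arcs G = {..<m}" "weighted_dag G w"
      "\<forall>i<k. s i \<in> verts G \<and> t i \<in> verts G" "(n + 2) ^ (k + 3) \<le> 2 ^ b"
    then interpret edsp_instance G w s t n m k b
      using assms by unfold_locales auto
    show "\<exists>T \<tau>. exec b (edsp_program k) (edsp_input k G w s t) T \<tau> \<and>
        T \<le> (31 + 22 * k) * (m * n ^ (k - 1) + 1) \<and> var \<tau> 0 = (if edsp k G w s t then 1 else 0)"
      using edsp_program_correct unfolding wp_def .
  qed
qed

end
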